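(* Let $\mathbb F_g$ be the free group on symbols $x_1,\dots,x_g$ ($g\ge 1$), and let $w_0,\dots,w_l,t_1,\dots,t_l\in \mathbb F_g$. Consider the set $$\mathcal A=\left\{(k_1,\dots,k_l)\in\mathbb Z^l : w_0t_1^{k_1}w_1t_2^{k_2}w_2\cdots t_l^{k_l}w_l=1 \text{ in } \mathbb F_g\right\}.$$ There is an algorithm which, given as input $w_0,\dots,w_l$ and $t_1,\dots,t_l$, returns a (finite) collection of sets $A_1,\dots,A_N$ such that $\mathcal A=A_1\cup\dots\cup A_N$, and each $A_j$ is of the form $$A_j=\left\{z_j+M_jv : v\in\mathbb Z_{\ge 0}^{d_j}\right\}$$ for some vector $z_j\in\mathbb Z^l$ and some matrix $M_j\in\mathbb Z^{l\times d_j}$.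
   Context: Elements of $\mathbb F_g$ are given to the algorithm as words in $x_1^{\pm1},\dots,x_g^{\pm1}$. The sets $A_j$ are returned by listing the integer vectors $z_j$ and the integer matrices $M_j$. *)

theory Defs
  imports
    "HOL-Library.Nat_Bijection"
    "HOL-Algebra.Group"
    "Jordan_Normal_Form.Matrix"
begin

section \<open>Free groups\<close>

text \<open>The letter \<open>(x, True)\<close> stands for the generator \<open>x\<close> and \<open>(x, False)\<close> for its
  formal inverse. Words need not be reduced.\<close>

type_synonym 'a word = "('a \<times> bool) list"

definition words :: "'a set \<Rightarrow> 'a word set" where
  "words X = lists (X \<times> UNIV)"

inductive_set free_cong :: "'a set \<Rightarrow> ('a word \<times> 'a word) set" for X :: "'a set" where
  cancel: "\<lbrakk>u \<in> words X; v \<in> words X; x \<in> X\<rbrakk>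
    \<Longrightarrow> (u @ [(x, b), (x, \<not> b)] @ v, u @ v) \<in> free_cong X"
| refl: "u \<in> words X \<Longrightarrow> (u, u) \<in> free_cong X"
| sym: "(u, v) \<in> free_cong X \<Longrightarrow> (v, u) \<in> free_cong X"
| trans: "\<lbrakk>(u, v) \<in> free_cong X; (v, w) \<in> free_cong X\<rbrakk> \<Longrightarrow> (u, w) \<in> free_cong X"

definition word_class :: "'a set \<Rightarrow> 'a word \<Rightarrow> 'a word set" where
  "word_class X u = free_cong X `` {u}"

definition free_group :: "'a set \<Rightarrow> 'a word set monoid" where
  "free_group X =
     \<lparr>carrier = words X // free_cong X,
      mult = (\<lambda>A B. \<Union>u\<in>A. \<Union>v\<in>B. word_class X (u @ v)),
      one = word_class X []\<rparr>"

lemma words_Nil [simp]: "[] \<in> words X"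
  and words_append [simp]: "u @ v \<in> words X \<longleftrightarrow> u \<in> words X \<and> v \<in> words X"
  and words_Cons [simp]: "a # v \<in> words X \<longleftrightarrow> fst a \<in> X \<and> v \<in> words X"
  by (auto simp: words_def mem_Times_iff)

lemma free_cong_words:
  assumes "(u, v) \<in> free_cong X"
  shows "u \<in> words X" "v \<in> words X"
  using assms by (induction rule: free_cong.induct) auto

lemma equiv_free_cong: "equiv (words X) (free_cong X)"
proof (rule equivI)
  show "free_cong X \<subseteq> words X \<times> words X"
    using free_cong_words by fastforce
  show "refl_on (words X) (free_cong X)"
    by (rule refl_onI) (rule free_cong.refl)
  show "Relation.sym (free_cong X)"
    by (rule symI) (rule free_cong.sym)
  show "Relation.trans (free_cong X)"
    by (rule transI) (rule free_cong.trans)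
qed

lemma free_cong_append_left:
  assumes "(u, v) \<in> free_cong X" "p \<in> words X"
  shows "(p @ u, p @ v) \<in> free_cong X"
  using assms
proof (induction rule: free_cong.induct)
  case (cancel u v x b)
  then show ?case using free_cong.cancel[of "p @ u" X v x b] by simp
next
  case (refl u)
  then show ?case by (simp add: free_cong.refl)
next
  case (sym u v)
  then show ?case by (blast intro: free_cong.sym)
next
  case (trans u v w)
  then show ?case by (blast intro: free_cong.trans)
qed

lemma free_cong_append_right:
  assumes "(u, v) \<in> free_cong X" "p \<in> words X"
  shows "(u @ p, v @ p) \<in> free_cong X"
  using assms
proof (induction rule: free_cong.induct)
  case (cancel u v x b)
  then show ?case using free_cong.cancel[of u X "v @ p" x b] by simp
next
  case (refl u)
  then show ?case by (simp add: free_cong.refl)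
next
  case (sym u v)
  then show ?case by (blast intro: free_cong.sym)
next
  case (trans u v w)
  then show ?case by (blast intro: free_cong.trans)
qed

lemma word_class_eq_iff:
  assumes "u \<in> words X" "v \<in> words X"
  shows "word_class X u = word_class X v \<longleftrightarrow> (u, v) \<in> free_cong X"
  unfolding word_class_def using eq_equiv_class_iff[OF equiv_free_cong assms] .

lemma carrier_free_group: "carrier (free_group X) = word_class X ` words X"
  by (auto simp: free_group_def quotient_def word_class_def)

lemma one_free_group: "\<one>\<^bsub>free_group X\<^esub> = word_class X []"
  by (simp add: free_group_def)

lemma mult_free_group:
  assumes "u \<in> words X" "v \<in> words X"
  shows "word_class X u \<otimes>\<^bsub>free_group X\<^esub> word_class X v = word_class X (u @ v)"
proof -
  have "word_class X (u' @ v') = word_class X (u @ v)"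
    if "(u, u') \<in> free_cong X" "(v, v') \<in> free_cong X" for u' v'
  proof -
    have "(u @ v, u' @ v') \<in> free_cong X"
      using that free_cong_append_right[OF that(1) assms(2)]
        free_cong_append_left[OF that(2) free_cong_words(2)[OF that(1)]]
      by (blast intro: free_cong.trans)
    moreover have "u' @ v' \<in> words X"
      using that by (simp add: free_cong_words)
    ultimately show ?thesis
      using assms by (simp add: word_class_eq_iff free_cong.sym)
  qed
  moreover have "(u, u) \<in> free_cong X" "(v, v) \<in> free_cong X"
    using assms by (auto intro: free_cong.refl)
  ultimately have "(\<Union>u'\<in>word_class X u. \<Union>v'\<in>word_class X v. word_class X (u' @ v'))
      = word_class X (u @ v)"
    unfolding word_class_def[of X u] word_class_def[of X v] by blast
  then show ?thesis by (simp add: free_group_def)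
qed

definition inv_word :: "'a word \<Rightarrow> 'a word" where
  "inv_word u = rev (map (\<lambda>(x, b). (x, \<not> b)) u)"

lemma inv_word_words: "u \<in> words X \<Longrightarrow> inv_word u \<in> words X"
  by (induction u) (auto simp: inv_word_def)

lemma inv_word_cancel:
  "u \<in> words X \<Longrightarrow> (inv_word u @ u, []) \<in> free_cong X"
proof (induction u)
  case Nil
  then show ?case by (simp add: inv_word_def free_cong.refl)
next
  case (Cons a u)
  obtain x b where a: "a = (x, b)" by (cases a)
  have "(inv_word u @ [(x, \<not> b), (x, \<not> \<not> b)] @ u, inv_word u @ u) \<in> free_cong X"
    using Cons.prems a by (intro free_cong.cancel) (auto intro: inv_word_words)
  then have "(inv_word (a # u) @ (a # u), inv_word u @ u) \<in> free_cong X"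
    by (simp add: a inv_word_def)
  then show ?case using Cons by (auto intro: free_cong.trans)
qed

lemma group_free_group: "group (free_group X)"
proof (rule groupI)
  fix A assume "A \<in> carrier (free_group X)"
  then obtain u where "u \<in> words X" "A = word_class X u"
    by (auto simp: carrier_free_group)
  then show "\<exists>B\<in>carrier (free_group X). B \<otimes>\<^bsub>free_group X\<^esub> A = \<one>\<^bsub>free_group X\<^esub>"
    by (auto simp: carrier_free_group one_free_group mult_free_group inv_word_words
        inv_word_cancel word_class_eq_iff intro!: bexI[of _ "inv_word u"])
qed (auto simp: carrier_free_group one_free_group mult_free_group)


section \<open>Exponential equations and linear sets\<close>

definition exp_product :: "('a, 'm) monoid_scheme \<Rightarrow> 'a list \<Rightarrow> 'a list \<Rightarrow> int vec \<Rightarrow> 'a" where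
  "exp_product G ws ts k =
     foldl (\<lambda>a i. a \<otimes>\<^bsub>G\<^esub> (ts ! i [^]\<^bsub>G\<^esub> (k $ i)) \<otimes>\<^bsub>G\<^esub> (ws ! Suc i)) (ws ! 0) [0..<length ts]"

definition exp_solutions :: "('a, 'm) monoid_scheme \<Rightarrow> 'a list \<Rightarrow> 'a list \<Rightarrow> int vec set" where
  "exp_solutions G ws ts = {k \<in> carrier_vec (length ts). exp_product G ws ts k = \<one>\<^bsub>G\<^esub>}"

definition linear_set :: "int vec \<Rightarrow> int mat \<Rightarrow> int vec set" where
  "linear_set z M =
     {z + M *\<^sub>v v | v. v \<in> carrier_vec (dim_col M) \<and> (\<forall>i < dim_col M. 0 \<le> v $ i)}"


section \<open>Algorithms: partial recursive functions\<close>

datatype recf =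
    Zero
  | Succ
  | Proj nat
  | Comp recf "recf list"
  | PrimRec recf recf
  | Mu recf

text \<open>\<open>rec_eval f xs y\<close>: the computation of \<open>f\<close> on the arguments \<open>xs\<close> halts with result \<open>y\<close>.
  The recursion argument of \<open>PrimRec\<close> and the search argument of \<open>Mu\<close> come first.\<close>

inductive rec_eval :: "recf \<Rightarrow> nat list \<Rightarrow> nat \<Rightarrow> bool" where
  Zero: "rec_eval Zero xs 0"
| Succ: "rec_eval Succ [x] (Suc x)"
| Proj: "i < length xs \<Longrightarrow> rec_eval (Proj i) xs (xs ! i)"
| Comp: "\<lbrakk>list_all2 (\<lambda>g y. rec_eval g xs y) gs ys; rec_eval f ys z\<rbrakk>
    \<Longrightarrow> rec_eval (Comp f gs) xs z"
| PrimRec_0: "rec_eval f xs y \<Longrightarrow> rec_eval (PrimRec f g) (0 # xs) y"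
| PrimRec_Suc: "\<lbrakk>rec_eval (PrimRec f g) (n # xs) y; rec_eval g (n # y # xs) z\<rbrakk>
    \<Longrightarrow> rec_eval (PrimRec f g) (Suc n # xs) z"
| Mu: "\<lbrakk>rec_eval f (n # xs) 0; \<forall>m<n. \<exists>y>0. rec_eval f (m # xs) y\<rbrakk>
    \<Longrightarrow> rec_eval (Mu f) xs n"

inductive_cases rec_eval_ZeroE: "rec_eval Zero xs y"
inductive_cases rec_eval_SuccE: "rec_eval Succ xs y"
inductive_cases rec_eval_ProjE: "rec_eval (Proj i) xs y"
inductive_cases rec_eval_CompE: "rec_eval (Comp f gs) xs y"
inductive_cases rec_eval_PrimRec_0E: "rec_eval (PrimRec f g) (0 # xs) y"
inductive_cases rec_eval_PrimRec_SucE: "rec_eval (PrimRec f g) (Suc n # xs) y"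
inductive_cases rec_eval_MuE: "rec_eval (Mu f) xs y"

lemma rec_eval_deterministic: "\<lbrakk>rec_eval f xs y; rec_eval f xs y'\<rbrakk> \<Longrightarrow> y = y'"
proof (induction arbitrary: y' rule: rec_eval.induct)
  case (Zero xs)
  from Zero.prems show ?case by (rule rec_eval_ZeroE) simp
next
  case (Succ x)
  from Succ.prems show ?case by (rule rec_eval_SuccE) simp
next
  case (Proj i xs)
  from Proj.prems show ?case by (rule rec_eval_ProjE) simp
next
  case (Comp xs gs ys f z)
  from Comp.prems obtain ys' where
    ys': "list_all2 (\<lambda>g y. rec_eval g xs y) gs ys'" "rec_eval f ys' y'"
    by (rule rec_eval_CompE)
  have "ys = ys'"
  proof (rule nth_equalityI)
    show "length ys = length ys'"
      using list_all2_lengthD[OF Comp.IH(1)] list_all2_lengthD[OF ys'(1)] by simp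
    show "ys ! i = ys' ! i" if "i < length ys" for i
      using list_all2_nthD2[OF Comp.IH(1) that] list_all2_nthD2[OF ys'(1), of i]
        that \<open>length ys = length ys'\<close> by simp
  qed
  then show ?case using Comp.IH(2)[of y'] ys'(2) by simp
next
  case (PrimRec_0 f xs y g)
  from PrimRec_0.prems have "rec_eval f xs y'" by (rule rec_eval_PrimRec_0E)
  then show ?case by (rule PrimRec_0.IH)
next
  case (PrimRec_Suc f g n xs y z)
  from PrimRec_Suc.prems obtain r where
    r: "rec_eval (PrimRec f g) (n # xs) r" "rec_eval g (n # r # xs) y'"
    by (rule rec_eval_PrimRec_SucE)
  show ?case using PrimRec_Suc.IH(1)[OF r(1)] r(2) PrimRec_Suc.IH(2) by simp
next
  case (Mu f n xs)
  from Mu.prems have y': "rec_eval f (y' # xs) 0" "\<forall>m<y'. \<exists>y>0. rec_eval f (m # xs) y"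
    by (rule rec_eval_MuE, blast)+
  have "\<not> n < y'"
  proof
    assume "n < y'"
    then obtain y where "y > 0" "rec_eval f (n # xs) y" using y'(2) by blast
    then show False using Mu.IH(1)[of y] by simp
  qed
  moreover have "\<not> y' < n"
  proof
    assume "y' < n"
    then obtain y where "y > 0" "\<And>y''. rec_eval f (y' # xs) y'' \<Longrightarrow> y = y''"
      using Mu.IH(2) by blast
    then show False using y'(1) by blast
  qed
  ultimately show ?case by simp
qed


section \<open>Coding of inputs and outputs\<close>

definition word_code :: "nat word \<Rightarrow> nat" where
  "word_code u = list_encode (map (\<lambda>(i, b). prod_encode (i, of_bool b)) u)"

definition words_code :: "nat word list \<Rightarrow> nat" where
  "words_code us = list_encode (map word_code us)"

definition vec_code :: "int vec \<Rightarrow> nat" where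
  "vec_code z = list_encode (map int_encode (list_of_vec z))"

text \<open>The number of rows is recorded because it cannot be read off from an empty list of columns.\<close>

definition mat_code :: "int mat \<Rightarrow> nat" where
  "mat_code M = prod_encode (dim_row M, list_encode (map vec_code (cols M)))"

definition output_code :: "(int vec \<times> int mat) list \<Rightarrow> nat" where
  "output_code As = list_encode (map (\<lambda>(z, M). prod_encode (vec_code z, mat_code M)) As)"

lemma inj_list_code: "inj f \<Longrightarrow> inj (\<lambda>xs. list_encode (map f xs))"
  by (rule injI) (simp add: list_encode_eq inj_map_eq_map)

lemma inj_words_code: "inj words_code"
proof -
  have "inj (\<lambda>(i, b). prod_encode (i, of_bool b))"
    by (rule injI) (clarsimp simp: of_bool_eq_iff)
  then have "inj word_code"
    unfolding word_code_def[abs_def] by (rule inj_list_code)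
  then show ?thesis
    unfolding words_code_def[abs_def] by (rule inj_list_code)
qed

lemma inj_vec_code: "inj vec_code"
proof (rule injI)
  fix z z' assume "vec_code z = vec_code z'"
  then have "list_of_vec z = list_of_vec z'"
    by (simp add: vec_code_def list_encode_eq inj_map_eq_map[OF inj_int_encode])
  then show "z = z'" by (metis vec_list)
qed

lemma inj_mat_code: "inj mat_code"
proof (rule injI)
  fix M M' assume "mat_code M = mat_code M'"
  then have "dim_row M = dim_row M'" "cols M = cols M'"
    by (simp_all add: mat_code_def list_encode_eq inj_map_eq_map[OF inj_vec_code])
  then show "M = M'" by (metis mat_of_cols_cols)
qed

lemma inj_output_code: "inj output_code"
proof -
  have "inj (\<lambda>(z, M). prod_encode (vec_code z, mat_code M))"
    by (rule injI) (clarsimp simp: inj_eq[OF inj_vec_code] inj_eq[OF inj_mat_code])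
  then show ?thesis
    unfolding output_code_def[abs_def] by (rule inj_list_code)
qed

end

theory Submission
  imports Defs "Jordan_Normal_Form.Determinant" "HOL-Computational_Algebra.Polynomial"
begin

text \<open>
  Completeness. Write every \<open>t\<^sub>i\<close> as a conjugate of a cyclically reduced word \<open>s\<^sub>i\<close>; a solution is then a
  trivial product of reduced words \<open>w\<^sub>0, s\<^sub>1\<^bsup>k\<^sub>1\<^esup>, w\<^sub>1, \<dots>\<close>. Successively removing a factor that is swallowed
  by its neighbours pairs off mutually inverse pieces of the factors, at most linearly many in \<open>l\<close>. Let
  \<open>P\<close> be a common period. A piece of length at least \<open>P\<close> lies in two powers and can be lengthened or
  shortened by multiples of \<open>P\<close> without disturbing the other pieces. So every solution lies in a linear set
  of solutions with computably bounded coefficients.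

  Soundness. The group has a faithful representation by two by two matrices, in which the entries of
  \<open>Y\<^sub>0 X\<^sub>1\<^sup>n Y\<^sub>1 \<cdots> X\<^sub>l\<^sup>n Y\<^sub>l\<close> satisfy a linear recurrence of order \<open>2\<^sup>l\<close>. Hence a linear set consists of
  solutions as soon as its points with parameters at most \<open>2\<^sup>l\<close> do.

  The algorithm lists all bounded pairs \<open>(z, M)\<close> that pass this finite test.
\<close>

text \<open>Diagrams are never computed. Completeness contributes only a bound on the entries of
  some pair \<open>(z, M)\<close>, and soundness decides whether a given pair is good; together they
  leave a finite search.

  The obstacle to pumping is that a factor is cut into several pieces, so that lengthening one piece
  moves the starting points of the later ones. Steps that are multiples of a common period keep
  these points in phase. The period \<open>P = (3 N + 1)!\<close> is divisible by the length of
  every nonempty cyclically reduced base and exceeds every constant factor, which is therefore never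
  pumped. Signs of exponents are frozen at those of one solution.

  The matrices avoid inverses: a letter and its inverse multiply to the scalar \<open>X^2\<close>,
  so a word \<open>u\<close> is trivial exactly when its matrix is \<open>X^(length u)\<close>.
  Along a line of exponents this is a geometric sequence, and a sequence of order \<open>D\<close>
  over an integral domain that agrees with it at \<open>0..D\<close> agrees with it
  everywhere.\<close>

definition flip :: "'a \<times> bool \<Rightarrow> 'a \<times> bool" where
  "flip a = (fst a, \<not> snd a)"

lemma flip_flip [simp]: "flip (flip a) = a"
  and flip_neq [simp]: "flip a \<noteq> a" "a \<noteq> flip a"
  by (auto simp: flip_def prod_eq_iff)

lemma flip_eq_iff [simp]: "flip a = flip b \<longleftrightarrow> a = b"
  by (metis flip_flip)

lemma eq_flip_commute: "a = flip b \<longleftrightarrow> b = flip a"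
  by (metis flip_flip)

lemma inv_word_eq: "inv_word u = rev (map flip u)"
  by (simp add: inv_word_def flip_def case_prod_beta')

lemma inv_word_simps [simp]:
  "inv_word [] = []" "inv_word (a # u) = inv_word u @ [flip a]"
  "inv_word (u @ v) = inv_word v @ inv_word u" "inv_word (inv_word u) = u"
  "length (inv_word u) = length u"
  by (simp_all add: inv_word_eq rev_map comp_def)

lemma words_inv_word [simp]: "inv_word u \<in> words X \<longleftrightarrow> u \<in> words X"
  by (metis inv_word_simps(4) inv_word_words)

section \<open>Congruence of words over the unrestricted alphabet\<close>

abbreviation fequiv :: "'a word \<Rightarrow> 'a word \<Rightarrow> bool" (infix \<open>\<approx>\<close> 50) where
  "u \<approx> v \<equiv> (u, v) \<in> free_cong UNIV"

lemma words_UNIV [simp]: "words UNIV = UNIV"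
  by (auto simp: words_def lists_eq_set)

lemma fequiv_refl [simp]: "u \<approx> u"
  by (simp add: free_cong.refl)

lemma fequiv_append: "\<lbrakk>u \<approx> u'; v \<approx> v'\<rbrakk> \<Longrightarrow> u @ v \<approx> u' @ v'"
  by (rule free_cong.trans[OF free_cong_append_right free_cong_append_left]) auto

lemma fequiv_inv_left: "inv_word u @ u \<approx> []"
  by (simp add: inv_word_cancel)

lemma fequiv_inv_right: "u @ inv_word u \<approx> []"
  using fequiv_inv_left[of "inv_word u"] by simp

lemma fequiv_cancel_left: "p @ inv_word u @ u @ q \<approx> p @ q"
  using fequiv_append[OF fequiv_refl[of p] fequiv_append[OF fequiv_inv_left[of u] fequiv_refl[of q]]]
  by simp

lemma fequiv_cancel_right: "p @ u @ inv_word u @ q \<approx> p @ q"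
  using fequiv_cancel_left[of p "inv_word u"] by simp

section \<open>Reduction\<close>

definition reduced :: "'a word \<Rightarrow> bool" where
  "reduced = successively (\<lambda>a b. b \<noteq> flip a)"

text \<open>The list is a stack: its head is the last letter of the reduced word read so far, so
  \<open>red\<close> reverses it at the end.\<close>

fun push :: "'a word \<Rightarrow> 'a \<times> bool \<Rightarrow> 'a word" where
  "push [] a = [a]"
| "push (b # s) a = (if b = flip a then s else a # b # s)"

definition red :: "'a word \<Rightarrow> 'a word" where
  "red u = rev (foldl push [] u)"

lemma reduced_Nil [simp]: "reduced []"
  and reduced_single [simp]: "reduced [a]"
  and reduced_Cons2 [simp]: "reduced (a # b # u) \<longleftrightarrow> b \<noteq> flip a \<and> reduced (b # u)"
  by (simp_all add: reduced_def)

lemma reduced_append: "reduced (u @ v) \<longleftrightarrow> reduced u \<and> reduced v \<and>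
    (u \<noteq> [] \<longrightarrow> v \<noteq> [] \<longrightarrow> hd v \<noteq> flip (last u))"
  by (auto simp: reduced_def successively_append_iff)

lemma reduced_rev [simp]: "reduced (rev u) \<longleftrightarrow> reduced u"
proof -
  have "(\<lambda>x y. x \<noteq> flip y) = (\<lambda>a b. b \<noteq> flip (a :: 'a \<times> bool))"
    by (intro ext) (metis flip_flip)
  then show ?thesis unfolding reduced_def successively_rev
    by (rule arg_cong[where f = "\<lambda>P. successively P u"])
qed

lemma reduced_push: "reduced s \<Longrightarrow> reduced (push s a)"
  by (cases "(s, a)" rule: push.cases) (auto simp: reduced_def successively_Cons eq_flip_commute)

text \<open>If the first step pops, reducedness of \<open>s\<close> keeps the newly exposed letter
  from cancelling, and the second step restores the popped one. This makes \<open>red\<close>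
  constant on congruence classes, so that normal forms are unique without a confluence
  argument.\<close>

lemma push_flip: "reduced s \<Longrightarrow> push (push s a) (flip a) = s"
proof (cases s)
  case (Cons b s')
  then show "reduced s \<Longrightarrow> push (push s a) (flip a) = s"
    by (cases s') auto
qed simp

lemma reduced_foldl_push: "reduced s \<Longrightarrow> reduced (foldl push s u)"
  by (induction u arbitrary: s) (auto intro: reduced_push)

lemma reduced_red: "reduced (red u)"
  by (simp add: red_def reduced_foldl_push)

lemma red_eq_if_free_cong: "(u, v) \<in> free_cong X \<Longrightarrow> red u = red v"
proof (induction rule: free_cong.induct)
  case (cancel u v x b)
  have "push (push s (x, b)) (x, \<not> b) = s" if "reduced s" for s
    using push_flip[OF that, of "(x, b)"] by (simp add: flip_def)
  then show ?case
    by (simp add: red_def reduced_foldl_push)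
qed auto

lemma free_cong_push:
  "s \<in> words X \<Longrightarrow> fst a \<in> X \<Longrightarrow> (rev s @ [a], rev (push s a)) \<in> free_cong X"
proof (cases s)
  case (Cons b s')
  assume *: "s \<in> words X" "fst a \<in> X"
  have rw: "rev s' \<in> words X" using * Cons by (auto simp: words_def)
  show ?thesis
  proof (cases "b = flip a")
    case True
    then show ?thesis
      using free_cong.cancel[OF rw words_Nil *(2), of "\<not> snd a"] Cons by (simp add: flip_def)
  next
    case False
    then show ?thesis using Cons * rw by (auto intro!: free_cong.refl)
  qed
qed (auto intro: free_cong.refl)

lemma words_push: "s \<in> words X \<Longrightarrow> fst a \<in> X \<Longrightarrow> push s a \<in> words X"
  by (cases s) auto

lemma words_foldl_push: "s \<in> words X \<Longrightarrow> u \<in> words X \<Longrightarrow> foldl push s u \<in> words X"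
  by (induction u arbitrary: s) (auto intro: words_push)

lemma words_rev [simp]: "rev u \<in> words X \<longleftrightarrow> u \<in> words X"
  by (simp add: words_def lists_eq_set)

lemma free_cong_red: "u \<in> words X \<Longrightarrow> (u, red u) \<in> free_cong X"
proof (induction u rule: rev_induct)
  case (snoc a u)
  have "(u @ [a], red u @ [a]) \<in> free_cong X"
    using snoc by (intro free_cong_append_right) auto
  moreover have "(red u @ [a], red (u @ [a])) \<in> free_cong X"
    using free_cong_push[of "foldl push [] u" X a] snoc.prems by (simp add: red_def words_foldl_push)
  ultimately show ?case by (rule free_cong.trans)
qed (simp add: red_def free_cong.refl)

text \<open>The right side does not mention \<open>X\<close>: a word over \<open>X\<close> is
  trivial over \<open>X\<close> exactly when it is trivial over all letters. The combinatorial part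
  can therefore ignore the generating set.\<close>

lemma free_cong_Nil_iff: "u \<in> words X \<Longrightarrow> (u, []) \<in> free_cong X \<longleftrightarrow> red u = []"
  using red_eq_if_free_cong[of u "[]" X] free_cong_red[of u X] by (auto simp: red_def)

lemma fequiv_Nil_iff: "u \<approx> [] \<longleftrightarrow> red u = []"
  by (simp add: free_cong_Nil_iff)

lemma fequiv_red: "u \<approx> red u"
  by (simp add: free_cong_red)

lemma foldl_push_reduced:
  "reduced (rev s @ u) \<Longrightarrow> foldl push s u = rev u @ s"
proof (induction u arbitrary: s)
  case (Cons a u)
  have "push s a = a # s"
    using Cons.prems by (cases s) (auto simp: reduced_append eq_flip_commute)
  then show ?case using Cons.IH[of "a # s"] Cons.prems by simp
qed simp

lemma red_reduced: "reduced u \<Longrightarrow> red u = u"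
  by (simp add: red_def foldl_push_reduced)

lemma reduced_fequiv_Nil: "reduced u \<Longrightarrow> u \<approx> [] \<Longrightarrow> u = []"
  by (simp add: fequiv_Nil_iff red_reduced)

lemma length_red: "length (red u) \<le> length u"
proof -
  have push: "length (push s a) \<le> Suc (length s)" for s :: "'a word" and a
    by (cases s) auto
  have "length (foldl push s u) \<le> length s + length u" for s
  proof (induction u arbitrary: s)
    case (Cons a u)
    show ?case using Cons.IH[of "push s a"] push[of s a] by simp
  qed simp
  from this[of "[]"] show ?thesis by (simp add: red_def)
qed

section \<open>Full cancellation\<close>

lemma maximal_cancellation:
  fixes s h :: "'a word"
  obtains s1 e h1 where "s = s1 @ e" "h = inv_word e @ h1"
    "s1 = [] \<or> h1 = [] \<or> hd h1 \<noteq> flip (last s1)"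
proof -
  have "\<exists>s1 e h1. s = s1 @ e \<and> h = inv_word e @ h1 \<and>
    (s1 = [] \<or> h1 = [] \<or> hd h1 \<noteq> flip (last s1))"
  proof (induction s arbitrary: h rule: rev_induct)
    case Nil
    then show ?case by auto
  next
    case (snoc a s)
    show ?case
    proof (cases "h \<noteq> [] \<and> hd h = flip a")
      case True
      then obtain h' where h: "h = flip a # h'" by (cases h) auto
      obtain s1 e h1 where "s = s1 @ e" "h' = inv_word e @ h1"
        "s1 = [] \<or> h1 = [] \<or> hd h1 \<noteq> flip (last s1)" using snoc.IH[of h'] by blast
      then show ?thesis using h
        by (intro exI[of _ s1] exI[of _ "e @ [a]"] exI[of _ h1]) auto
    next
      case False
      then show ?thesis
        by (intro exI[of _ "s @ [a]"] exI[of _ "[]"] exI[of _ h]) auto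
    qed
  qed
  then show ?thesis using that by blast
qed

text \<open>Here \<open>r @ s\<close> is the reduced remnant of what has been read, and
  \<open>s\<close> the nonempty remnant of the current factor \<open>c0 @ s\<close>. Maximal
  cancellation of \<open>s\<close> against the next factor either exhausts one of the two, which
  gives the conclusion, or leaves a reduced remnant with a nonempty end again. The latter cannot
  last to the end, because a nonempty reduced word is not trivial. The final \<open>[]\<close> is a
  right neighbour for the last factor.\<close>

lemma full_cancellation_aux:
  assumes "s \<noteq> []" "reduced (r @ s)" "list_all reduced gs" "r @ s @ concat gs \<approx> []"
  shows "(\<exists>y B. gs @ [[]] = (inv_word s @ y) # B) \<or>
    (\<exists>A x c d y B. (c0 @ s) # gs @ [[]] = A @ [x @ inv_word c, c @ d, inv_word d @ y] @ B)"
  using assms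
proof (induction gs arbitrary: r s c0)
  case Nil
  then show ?case using reduced_fequiv_Nil[of "r @ s"] by auto
next
  case (Cons h gs)
  obtain s1 e h1 where s: "s = s1 @ e" and h: "h = inv_word e @ h1"
    and mx: "s1 = [] \<or> h1 = [] \<or> hd h1 \<noteq> flip (last s1)"
    by (rule maximal_cancellation[of s h])
  show ?case
  proof (cases "s1 = [] \<or> h1 = []")
    case True
    then show ?thesis
    proof
      assume "s1 = []"
      then show ?thesis using s h by auto
    next
      assume "h1 = []"
      obtain y B where "gs @ [[]] = y # B" by (cases gs) auto
      then have "(c0 @ s) # (h # gs) @ [[]] =
          [] @ [(c0 @ s1) @ inv_word (inv_word e), inv_word e @ [], inv_word [] @ y] @ B"
        using s h \<open>h1 = []\<close> by simp
      then show ?thesis by blast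
    qed
  next
    case False
    have red: "reduced ((r @ s1) @ h1)"
      using Cons.prems(2,3) False mx unfolding s h by (auto simp: reduced_append)
    have "(r @ s1) @ e @ inv_word e @ h1 @ concat gs \<approx> (r @ s1) @ h1 @ concat gs"
      by (rule fequiv_cancel_right)
    then have eq: "(r @ s1) @ h1 @ concat gs \<approx> []"
      using Cons.prems(4) unfolding s h by (auto intro: free_cong.trans free_cong.sym)
    have "(\<exists>y B. gs @ [[]] = (inv_word h1 @ y) # B) \<or>
      (\<exists>A x c d y B. (inv_word e @ h1) # gs @ [[]] = A @ [x @ inv_word c, c @ d, inv_word d @ y] @ B)"
      using False Cons.prems(3) by (intro Cons.IH[OF _ red _ eq]) auto
    then show ?thesis
    proof (elim disjE exE)
      fix y B assume "gs @ [[]] = (inv_word h1 @ y) # B"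
      then have "(c0 @ s) # (h # gs) @ [[]] =
          [] @ [(c0 @ s1) @ inv_word (inv_word e), inv_word e @ h1, inv_word h1 @ y] @ B"
        using s h by simp
      then show ?thesis by blast
    next
      fix A x c d y B
      assume "(inv_word e @ h1) # gs @ [[]] = A @ [x @ inv_word c, c @ d, inv_word d @ y] @ B"
      then have "(c0 @ s) # (h # gs) @ [[]] =
          ((c0 @ s) # A) @ [x @ inv_word c, c @ d, inv_word d @ y] @ B"
        using h by simp
      then show ?thesis by blast
    qed
  qed
qed

text \<open>If no factor were swallowed by its two neighbours, a nonempty rest of each factor would
  survive when the product is reduced from left to right.\<close>

lemma full_cancellation:
  assumes "gs \<noteq> []" "list_all reduced gs" "concat gs \<approx> []"
  obtains A x c d y B where
    "[] # gs @ [[]] = A @ [x @ inv_word c, c @ d, inv_word d @ y] @ B"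
proof -
  obtain h gs' where gs: "gs = h # gs'" using assms(1) by (cases gs) auto
  have "\<exists>A x c d y B. [] # gs @ [[]] = A @ [x @ inv_word c, c @ d, inv_word d @ y] @ B"
  proof (cases "h = []")
    case True
    obtain y B where "gs' @ [[]] = y # B" by (cases gs') auto
    then have "[] # gs @ [[]] = [] @ [[] @ inv_word [], [] @ [], inv_word [] @ y] @ B"
      using gs True by simp
    then show ?thesis by blast
  next
    case False
    have "(\<exists>y B. gs' @ [[]] = (inv_word h @ y) # B) \<or>
      (\<exists>A x c d y B. ([] @ h) # gs' @ [[]] = A @ [x @ inv_word c, c @ d, inv_word d @ y] @ B)"
      using assms gs False by (intro full_cancellation_aux[where r = "[]"]) auto
    then show ?thesis
    proof (elim disjE exE)
      fix y B assume "gs' @ [[]] = (inv_word h @ y) # B"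
      then have "[] # gs @ [[]] = [] @ [[] @ inv_word [], [] @ h, inv_word h @ y] @ B"
        using gs by simp
      then show ?thesis by blast
    next
      fix A x c d y B
      assume "([] @ h) # gs' @ [[]] = A @ [x @ inv_word c, c @ d, inv_word d @ y] @ B"
      then have "[] # gs @ [[]] = ([] # A) @ [x @ inv_word c, c @ d, inv_word d @ y] @ B"
        using gs by simp
      then show ?thesis by blast
    qed
  qed
  then show ?thesis using that by blast
qed

section \<open>Cancellation diagrams\<close>

text \<open>A factor is an infinite letter sequence together with a length, so that pumping it means
  reading the same sequence up to another point.\<close>

type_synonym 'a side = "(nat \<Rightarrow> 'a \<times> bool) \<times> nat"

definition seg :: "'a side \<Rightarrow> 'a word" where
  "seg \<sigma> = map (fst \<sigma>) [0..<snd \<sigma>]"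

definition shift :: "nat \<Rightarrow> (nat \<Rightarrow> 'b) \<Rightarrow> nat \<Rightarrow> 'b" where
  "shift k f = (\<lambda>j. f (j + k))"

lemma length_seg [simp]: "length (seg \<sigma>) = snd \<sigma>"
  by (simp add: seg_def)

lemma seg_0 [simp]: "seg (f, 0) = []"
  by (simp add: seg_def)

lemma seg_add: "seg (f, a + b) = seg (f, a) @ seg (shift a f, b)"
proof -
  have "map f [a..<a + b] = map (shift a f) [0..<b]"
    by (rule nth_equalityI) (auto simp: shift_def add.commute)
  then show ?thesis by (simp add: seg_def upt_add_eq_append[of 0])
qed

definition opposite :: "nat \<Rightarrow> (nat \<Rightarrow> 'a \<times> bool) \<Rightarrow> (nat \<Rightarrow> 'a \<times> bool) \<Rightarrow> bool" where
  "opposite n f h \<longleftrightarrow> (\<forall>j<n. h j = flip (f (n - Suc j)))"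

lemma seg_opposite: "opposite n f h \<longleftrightarrow> seg (h, n) = inv_word (seg (f, n))"
  by (auto simp: opposite_def list_eq_iff_nth_eq seg_def inv_word_eq rev_nth)

text \<open>A planar pairing of mutually inverse segments with \<open>p\<close> pairs. Factors are
  cut into segments for the pairing, and \<open>merge\<close> glues neighbouring segments of one
  factor together again.\<close>

inductive diagram :: "nat \<Rightarrow> 'a side list \<Rightarrow> bool" where
  empty: "diagram 0 []"
| pair: "\<lbrakk>diagram p (A @ B); opposite n f h\<rbrakk> \<Longrightarrow> diagram (Suc p) (A @ [(f, n), (h, n)] @ B)"
| merge: "diagram p (A @ [(f, a), (shift a f, b)] @ B) \<Longrightarrow> diagram p (A @ [(f, a + b)] @ B)"

text \<open>The empty sides at both ends give every other factor two neighbours. Removing a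
  swallowed factor costs two pairs, one for each neighbour, and the two ends finally form one pair:
  \<open>2 (n - 2) + 1 = 2 n - 3\<close> for \<open>n\<close> sides.\<close>

lemma diagram_of_trivial:
  assumes "length ss \<ge> 2" "snd (hd ss) = 0" "snd (last ss) = 0"
    "list_all (\<lambda>\<sigma>. reduced (seg \<sigma>)) ss" "concat (map seg ss) \<approx> []"
  shows "diagram (2 * length ss - 3) ss"
  using assms
proof (induction "length ss" arbitrary: ss rule: less_induct)
  case less
  obtain \<sigma> ss' where "ss = \<sigma> # ss'" using less.prems(1) by (cases ss) auto
  moreover obtain mid \<tau> where "ss' = mid @ [\<tau>]" using calculation less.prems(1)
    by (cases ss' rule: rev_cases) auto
  ultimately have ss: "ss = \<sigma> # mid @ [\<tau>]" by simp
  obtain f g where \<sigma>: "\<sigma> = (f, 0)" and \<tau>: "\<tau> = (g, 0)"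
    using less.prems(2,3) ss by (cases \<sigma>; cases \<tau>) auto
  show ?case
  proof (cases "mid = []")
    case True
    have "diagram (Suc 0) ([] @ [(f, 0), (g, 0)] @ [])"
      by (rule diagram.pair) (auto simp: opposite_def intro: diagram.empty)
    then show ?thesis using True ss \<sigma> \<tau> by simp
  next
    case False
    obtain A x c d y B where eq:
      "[] # map seg mid @ [[]] = A @ [x @ inv_word c, c @ d, inv_word d @ y] @ B"
      using less.prems(4,5) False ss
      by (auto elim!: full_cancellation[rotated 2] simp: \<sigma> \<tau> list_all_iff)
    have "map seg ss = A @ [x @ inv_word c, c @ d, inv_word d @ y] @ B"
      using eq ss \<sigma> \<tau> by simp
    then obtain A' f1 n1 f2 n2 f3 n3 B' where
      ss': "ss = A' @ [(f1, n1), (f2, n2), (f3, n3)] @ B'"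
      and segs: "map seg A' = A" "seg (f1, n1) = x @ inv_word c" "seg (f2, n2) = c @ d"
        "seg (f3, n3) = inv_word d @ y" "map seg B' = B"
      by (auto simp: map_eq_append_conv map_eq_Cons_conv)
    have n1: "n1 = length x + length c" and n2: "n2 = length c + length d"
      and n3: "n3 = length d + length y"
      using arg_cong[OF segs(2), of length] arg_cong[OF segs(3), of length]
        arg_cong[OF segs(4), of length] by auto
    have s1: "seg (f1, length x) = x" "seg (shift (length x) f1, length c) = inv_word c"
      using segs(2) unfolding n1 seg_add by (auto simp: append_eq_append_conv)
    have s2: "seg (f2, length c) = c" "seg (shift (length c) f2, length d) = d"
      using segs(3) unfolding n2 seg_add by (auto simp: append_eq_append_conv)
    have s3: "seg (f3, length d) = inv_word d" "seg (shift (length d) f3, length y) = y"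
      using segs(4) unfolding n3 seg_add by (auto simp: append_eq_append_conv)
    define ss2 where "ss2 = A' @ [(f1, length x), (shift (length d) f3, length y)] @ B'"
    have "diagram (2 * length ss2 - 3) ss2"
    proof (rule less.hyps)
      show "length ss2 < length ss" "2 \<le> length ss2" by (simp_all add: ss2_def ss')
      show "snd (hd ss2) = 0" using less.prems(2) unfolding ss2_def ss'
        by (cases A') (auto simp: n1)
      show "snd (last ss2) = 0" using less.prems(3) unfolding ss2_def ss'
        by (cases B' rule: rev_cases) (auto simp: n3)
      show "list_all (\<lambda>\<sigma>. reduced (seg \<sigma>)) ss2" using less.prems(4) segs
        unfolding ss2_def ss' by (auto simp: s1 s3 reduced_append)
      have "concat (map seg A') @ x @ inv_word c @ c @ d @ inv_word d @ y @ concat (map seg B')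
        \<approx> concat (map seg A') @ x @ d @ inv_word d @ y @ concat (map seg B')"
        using fequiv_cancel_left[of "concat (map seg A') @ x" c "d @ inv_word d @ y @ concat (map seg B')"]
        by simp
      moreover have "concat (map seg A') @ x @ d @ inv_word d @ y @ concat (map seg B')
        \<approx> concat (map seg A') @ x @ y @ concat (map seg B')"
        using fequiv_cancel_right[of "concat (map seg A') @ x" d "y @ concat (map seg B')"]
        by simp
      moreover have "concat (map seg ss) =
        concat (map seg A') @ x @ inv_word c @ c @ d @ inv_word d @ y @ concat (map seg B')"
        by (simp add: ss' segs)
      moreover have "concat (map seg ss2) = concat (map seg A') @ x @ y @ concat (map seg B')"
        by (simp add: ss2_def s1 s3)
      ultimately show "concat (map seg ss2) \<approx> []"
        using less.prems(5) by (metis free_cong.sym free_cong.trans)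
    qed
    \<comment> \<open>The swallowed factor is put back: first the pair for \<open>d\<close>, then
      the pair for \<open>c\<close>, and three merges restore the left neighbour, the factor and the
      right neighbour.\<close>
    then have "diagram (2 * length ss2 - 3) ((A' @ [(f1, length x)]) @ (shift (length d) f3, length y) # B')"
      by (simp add: ss2_def)
    then have "diagram (Suc (2 * length ss2 - 3)) ((A' @ [(f1, length x)]) @
        [(shift (length c) f2, length d), (f3, length d)] @ (shift (length d) f3, length y) # B')"
      by (rule diagram.pair) (simp add: seg_opposite s2 s3)
    then have "diagram (Suc (2 * length ss2 - 3)) ((A' @ [(f1, length x)]) @
        ((shift (length c) f2, length d) # (f3, length d) # (shift (length d) f3, length y) # B'))"
      by simp
    then have "diagram (Suc (Suc (2 * length ss2 - 3))) ((A' @ [(f1, length x)]) @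
        [(shift (length x) f1, length c), (f2, length c)] @
        ((shift (length c) f2, length d) # (f3, length d) # (shift (length d) f3, length y) # B'))"
      by (rule diagram.pair) (simp add: seg_opposite s1 s2)
    then have "diagram (Suc (Suc (2 * length ss2 - 3))) (A' @
        [(f1, length x), (shift (length x) f1, length c)] @
        ((f2, length c) # (shift (length c) f2, length d) # (f3, length d) # (shift (length d) f3, length y) # B'))"
      by simp
    from diagram.merge[OF this]
    have "diagram (Suc (Suc (2 * length ss2 - 3))) ((A' @ [(f1, n1)]) @
        [(f2, length c), (shift (length c) f2, length d)] @
        ((f3, length d) # (shift (length d) f3, length y) # B'))"
      by (simp add: n1)
    from diagram.merge[OF this]
    have "diagram (Suc (Suc (2 * length ss2 - 3))) ((A' @ [(f1, n1), (f2, n2)]) @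
        [(f3, length d), (shift (length d) f3, length y)] @ B')"
      by (simp add: n2)
    from diagram.merge[OF this]
    have "diagram (Suc (Suc (2 * length ss2 - 3))) ss"
      by (simp add: n3 ss')
    moreover have "Suc (Suc (2 * length ss2 - 3)) = 2 * length ss - 3"
      by (simp add: ss' ss2_def)
    ultimately show ?thesis by simp
  qed
qed

section \<open>Pumping\<close>

text \<open>The length is now an affine function of parameters, one for each pair of the
  diagram.\<close>

type_synonym 'a pside = "(nat \<Rightarrow> 'a \<times> bool) \<times> nat \<times> (nat \<Rightarrow> nat)"

definition eval_side :: "nat \<Rightarrow> (nat \<Rightarrow> nat) \<Rightarrow> 'a pside \<Rightarrow> 'a side" where
  "eval_side p v = (\<lambda>(f, z, r). (f, z + (\<Sum>j<p. r j * v j)))"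

definition periodic :: "nat \<Rightarrow> (nat \<Rightarrow> 'b) \<Rightarrow> bool" where
  "periodic P f \<longleftrightarrow> (\<forall>j. f (j + P) = f j)"

lemma periodic_mult: "periodic P f \<Longrightarrow> f (j + P * q) = f j"
proof (induction q)
  case (Suc q)
  have "f (j + P * Suc q) = f ((j + P * q) + P)" by (simp add: algebra_simps)
  also have "\<dots> = f j" using Suc by (simp add: periodic_def)
  finally show ?case .
qed simp

lemma periodic_mod: "periodic P f \<Longrightarrow> f (j mod P) = f j"
  using periodic_mult[of P f "j mod P" "j div P"] by simp

lemma periodic_cong: "periodic P f \<Longrightarrow> i mod P = j mod P \<Longrightarrow> f i = f j"
  by (metis periodic_mod)

lemma periodic_shift: "periodic P f \<Longrightarrow> periodic P (shift k f)"
  unfolding periodic_def shift_def by (metis add.assoc add.commute)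

lemma shift_periodic_cong: "periodic P f \<Longrightarrow> a mod P = b mod P \<Longrightarrow> shift a f = shift b f"
  unfolding shift_def by (rule ext, rule periodic_cong, assumption) (metis mod_add_right_eq)

text \<open>The condition at \<open>j\<close> depends only on \<open>j\<close> and
  \<open>n - Suc j\<close> modulo \<open>P\<close>. The conditions on one full period, available
  since \<open>P \<le> n\<close>, thus imply all conditions for every length congruent to
  \<open>n\<close>, shorter or longer.\<close>

lemma opposite_extend:
  assumes "periodic P f" "periodic P h" "opposite n f h" "P \<le> n" "n mod P = m mod P" "P > 0"
  shows "opposite m f h"
  unfolding opposite_def
proof (intro allI impI)
  fix j assume j: "j < m"
  have j': "j mod P < n" using assms(4,6) by (meson mod_less_divisor less_le_trans)
  have "h j = h (j mod P)" using assms(2) by (simp add: periodic_mod)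
  also have "\<dots> = flip (f (n - Suc (j mod P)))" using assms(3) j' by (simp add: opposite_def)
  also have "f (n - Suc (j mod P)) = f (m - Suc j)"
  proof (rule periodic_cong[OF assms(1)])
    have "(int n - int (Suc (j mod P))) mod int P = (int m - int (Suc j)) mod int P"
    proof -
      have "int n mod int P = int m mod int P" using assms(5) by (metis of_nat_mod)
      moreover have "int (Suc (j mod P)) mod int P = int (Suc j) mod int P"
        by (metis mod_Suc_eq of_nat_mod)
      ultimately show ?thesis by (metis mod_diff_cong)
    qed
    then have "int (n - Suc (j mod P)) mod int P = int (m - Suc j) mod int P"
      using j j' by (simp add: of_nat_diff Suc_leI)
    then show "(n - Suc (j mod P)) mod P = (m - Suc j) mod P"
      by (metis of_nat_eq_iff of_nat_mod)
  qed
  finally show "h j = flip (f (m - Suc j))" .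
qed

text \<open>Divisibility of the coefficients by \<open>P\<close> keeps later segments of a factor in
  phase, and the clause on \<open>n < P\<close> keeps short factors rigid. In the bounds, a pair
  contributes a constant of at most \<open>2 * P\<close> to each of its two segments, and its own
  parameter enters each of them with coefficient at most \<open>P\<close>.\<close>

definition pumps :: "nat \<Rightarrow> nat \<Rightarrow> 'a side list \<Rightarrow> 'a pside list \<Rightarrow> bool" where
  "pumps P p ss R \<longleftrightarrow>
     (\<exists>v. ss = map (eval_side p v) R) \<and>
     (\<forall>v. concat (map (seg \<circ> eval_side p v) R) \<approx> []) \<and>
     (\<forall>(f, z, r) \<in> set R. \<forall>j<p. P dvd r j) \<and>
     list_all2 (\<lambda>(f, n) (g, z, r). n < P \<longrightarrow> (\<forall>j<p. r j = 0)) ss R \<and>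
     (\<Sum>(f, z, r)\<leftarrow>R. z) \<le> 4 * P * p \<and> (\<forall>j<p. (\<Sum>(f, z, r)\<leftarrow>R. r j) \<le> 2 * P)"

lemma diagram_pumps:
  assumes "diagram p ss" "P > 0" "\<forall>(f, n) \<in> set ss. periodic P f"
  shows "\<exists>R. pumps P p ss R"
  using assms(1,3)
proof (induction rule: diagram.induct)
  case empty
  show ?case by (rule exI[of _ "[]"]) (simp add: pumps_def)
next
  case (pair p A B n f h)
  then obtain R where R: "pumps P p (A @ B) R" by auto
  then obtain v where v: "A @ B = map (eval_side p v) R" by (auto simp: pumps_def)
  define RA where "RA = take (length A) R"
  define RB where "RB = drop (length A) R"
  have RAB: "R = RA @ RB" by (simp add: RA_def RB_def)
  have lenA: "length A = length RA" using arg_cong[OF v, of length] by (simp add: RA_def)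
  have vA: "A = map (eval_side p v) RA" and vB: "B = map (eval_side p v) RB"
    using v lenA by (simp_all add: RAB append_eq_append_conv)
  \<comment> \<open>A pair shorter than \<open>P\<close> is frozen. A longer one retains one full
    period, which is what \<open>opposite_extend\<close> requires, and grows from there in steps of
    \<open>P\<close>.\<close>
  define c where "c = (if n < P then 0 else P)"
  define z0 where "z0 = (if n < P then n else P + n mod P)"
  define ext :: "'a pside \<Rightarrow> 'a pside" where "ext = (\<lambda>(f, z, r). (f, z, r(p := 0)))"
  define row where "row = (\<lambda>j. if j = p then c else (0::nat))"
  define R' where "R' = map ext RA @ [(f, z0, row), (h, z0, row)] @ map ext RB"
  have ev_ext: "eval_side (Suc p) w (ext \<sigma>) = eval_side p w \<sigma>" for w \<sigma>
    by (auto simp: eval_side_def ext_def split: prod.splits intro!: sum.cong)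
  have ev_row: "eval_side (Suc p) w (g, z0, row) = (g, z0 + c * w p)" for w and g :: "nat \<Rightarrow> 'a \<times> bool"
    by (simp add: eval_side_def row_def)
  have ev_upd: "eval_side p (v(p := k)) \<sigma> = eval_side p v \<sigma>" for k \<sigma>
    by (auto simp: eval_side_def split: prod.splits intro!: sum.cong)
  have perf: "periodic P f" "periodic P h" using pair.prems by auto
  have z0n: "z0 + c * (if n < P then 0 else n div P - 1) = n"
  proof (cases "n < P")
    case False
    then have "n div P \<ge> 1" using assms(2) by (simp add: Suc_le_eq div_greater_zero_iff)
    then have "P * (n div P - 1) = P * (n div P) - P" "P * (n div P) \<ge> P"
      by (auto simp: diff_mult_distrib2)
    then show ?thesis using False mult_div_mod_eq[of P n] unfolding z0_def c_def by simp
  qed (simp add: z0_def c_def)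
  have opp: "opposite (z0 + c * k) f h" for k
  proof (cases "n < P")
    case True
    then show ?thesis using pair.hyps by (simp add: z0_def c_def)
  next
    case False
    then show ?thesis using opposite_extend[OF perf pair.hyps(2) _ _ assms(2)]
      by (simp add: z0_def c_def)
  qed
  have "pumps P (Suc p) (A @ [(f, n), (h, n)] @ B) R'"
    unfolding pumps_def
  proof (intro conjI)
    show "\<exists>w. A @ [(f, n), (h, n)] @ B = map (eval_side (Suc p) w) R'"
      using z0n by (intro exI[of _ "v(p := if n < P then 0 else n div P - 1)"])
        (auto simp: R'_def ev_ext ev_row ev_upd vA vB)
    show "\<forall>w. concat (map (seg \<circ> eval_side (Suc p) w) R') \<approx> []"
    proof
      fix w
      let ?u = "\<lambda>T. concat (map (seg \<circ> eval_side p w) T)"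
      have "concat (map (seg \<circ> eval_side (Suc p) w) R') = ?u RA @ seg (f, z0 + c * w p) @
          inv_word (seg (f, z0 + c * w p)) @ ?u RB"
        using opp[of "w p"] by (simp add: R'_def ev_ext ev_row seg_opposite comp_def)
      moreover have "?u RA @ ?u RB \<approx> []" using R by (simp add: pumps_def RAB)
      ultimately show "concat (map (seg \<circ> eval_side (Suc p) w) R') \<approx> []"
        by (metis fequiv_cancel_right free_cong.trans)
    qed
    show "\<forall>(f, z, r)\<in>set R'. \<forall>j<Suc p. P dvd r j"
    proof -
      have "\<forall>(f, z, r)\<in>set R. \<forall>j<p. P dvd r j" using R by (simp add: pumps_def)
      then show ?thesis
        by (fastforce simp: R'_def ext_def row_def c_def RAB less_Suc_eq)
    qed
    show "list_all2 (\<lambda>(f, n) (g, z, r). n < P \<longrightarrow> (\<forall>j<Suc p. r j = 0)) (A @ [(f, n), (h, n)] @ B) R'"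
    proof -
      have "list_all2 (\<lambda>(f, n) (g, z, r). n < P \<longrightarrow> (\<forall>j<p. r j = 0)) (A @ B) R"
        using R by (auto simp: pumps_def)
      then have "list_all2 (\<lambda>(f, n) (g, z, r). n < P \<longrightarrow> (\<forall>j<p. r j = 0)) A RA"
        "list_all2 (\<lambda>(f, n) (g, z, r). n < P \<longrightarrow> (\<forall>j<p. r j = 0)) B RB"
        using lenA by (simp_all add: RAB list_all2_append)
      then show ?thesis using lenA unfolding R'_def
        by (auto simp: list_all2_append list_all2_map2 ext_def row_def c_def less_Suc_eq
            elim!: list_all2_mono)
    qed
    have z0le: "z0 \<le> 2 * P" using assms(2) by (simp add: z0_def less_imp_le mult_2)
    have "(\<Sum>(f, z, r)\<leftarrow>R'. z) = (\<Sum>(f, z, r)\<leftarrow>R. z) + 2 * z0"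
      by (simp add: R'_def RAB ext_def comp_def case_prod_beta')
    also have "\<dots> \<le> 4 * P * Suc p"
      using R z0le by (simp add: pumps_def algebra_simps)
    finally show "(\<Sum>(f, z, r)\<leftarrow>R'. z) \<le> 4 * P * Suc p" .
    show "\<forall>j<Suc p. (\<Sum>(f, z, r)\<leftarrow>R'. r j) \<le> 2 * P"
    proof (intro allI impI)
      fix j assume "j < Suc p"
      then consider "j = p" | "j < p" by linarith
      then show "(\<Sum>(f, z, r)\<leftarrow>R'. r j) \<le> 2 * P"
      proof cases
        case 1
        then show ?thesis
          by (simp add: R'_def ext_def comp_def case_prod_beta' row_def c_def sum_list_triv)
      next
        case 2
        then have "(\<Sum>(f, z, r)\<leftarrow>R'. r j) = (\<Sum>(f, z, r)\<leftarrow>R. r j)"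
          by (simp add: R'_def RAB ext_def comp_def case_prod_beta' row_def)
        then show ?thesis using R 2 by (simp add: pumps_def)
      qed
    qed
  qed
  then show ?case by blast
next
  case (merge p A f a b B)
  have perf: "periodic P f" using merge.prems by auto
  then have "\<forall>(f, n)\<in>set (A @ [(f, a), (shift a f, b)] @ B). periodic P f"
    using merge.prems by (auto intro: periodic_shift)
  then obtain R where R: "pumps P p (A @ [(f, a), (shift a f, b)] @ B) R"
    using merge.IH by blast
  then obtain v where v: "A @ [(f, a), (shift a f, b)] @ B = map (eval_side p v) R"
    by (auto simp: pumps_def)
  then obtain RA z1 r1 z2 r2 RB where RAB: "R = RA @ [(f, z1, r1), (shift a f, z2, r2)] @ RB"
    and vA: "map (eval_side p v) RA = A" and vB: "map (eval_side p v) RB = B"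
    and a: "a = z1 + (\<Sum>j<p. r1 j * v j)" and b: "b = z2 + (\<Sum>j<p. r2 j * v j)"
    by (auto simp: append_eq_map_conv Cons_eq_map_conv eval_side_def)
  define row where "row = (\<lambda>j. r1 j + r2 j)"
  define R' where "R' = RA @ [(f, z1 + z2, row)] @ RB"
  have ev: "eval_side p w (f, z1 + z2, row) =
      (f, (z1 + (\<Sum>j<p. r1 j * w j)) + (z2 + (\<Sum>j<p. r2 j * w j)))" for w
    by (simp add: eval_side_def row_def algebra_simps sum.distrib)
  have dvd1: "P dvd (\<Sum>j<p. r1 j * w j)" for w
    using R unfolding pumps_def RAB by (intro dvd_sum dvd_mult2) auto
  have "pumps P p (A @ [(f, a + b)] @ B) R'"
    unfolding pumps_def
  proof (intro conjI)
    show "\<exists>w. A @ [(f, a + b)] @ B = map (eval_side p w) R'"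
      by (intro exI[of _ v]) (simp add: R'_def ev vA vB a b)
    show "\<forall>w. concat (map (seg \<circ> eval_side p w) R') \<approx> []"
    proof
      fix w
      \<comment> \<open>The pumped first segment ends in the same phase as before, so the second one
        still reads the continuation of \<open>f\<close> and the two can be glued for all
        parameters.\<close>
      have "(z1 + (\<Sum>j<p. r1 j * w j)) mod P = a mod P"
        unfolding a using dvd1[of w] dvd1[of v] by (simp add: mod_add_eq[symmetric, of z1] dvd_imp_mod_0)
      then have "shift (z1 + (\<Sum>j<p. r1 j * w j)) f = shift a f"
        by (rule shift_periodic_cong[OF perf])
      then have "seg (eval_side p w (f, z1 + z2, row)) =
          seg (eval_side p w (f, z1, r1)) @ seg (eval_side p w (shift a f, z2, r2))"
        unfolding ev seg_add[of f "z1 + _"] by (simp add: eval_side_def)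
      then have "concat (map (seg \<circ> eval_side p w) R') = concat (map (seg \<circ> eval_side p w) R)"
        by (simp add: R'_def RAB)
      then show "concat (map (seg \<circ> eval_side p w) R') \<approx> []"
        using R by (simp add: pumps_def)
    qed
    show "\<forall>(f, z, r)\<in>set R'. \<forall>j<p. P dvd r j"
      using R by (auto simp: R'_def row_def pumps_def RAB)
    have "length A = length RA" using vA by auto
    then show "list_all2 (\<lambda>(f, n) (g, z, r). n < P \<longrightarrow> (\<forall>j<p. r j = 0)) (A @ [(f, a + b)] @ B) R'"
      using R by (auto simp: pumps_def RAB R'_def list_all2_append row_def)
    show "(\<Sum>(f, z, r)\<leftarrow>R'. z) \<le> 4 * P * p"
      using R by (simp add: pumps_def R'_def RAB)
    show "\<forall>j<p. (\<Sum>(f, z, r)\<leftarrow>R'. r j) \<le> 2 * P"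
      using R by (auto simp: pumps_def R'_def RAB row_def)
  qed
  then show ?case by blast
qed

section \<open>Two by two matrices\<close>

text \<open>Matrices of this fixed size form an instance of \<open>ring_1\<close>, so that powers,
  sums and \<open>prod_list\<close> come without dimension conditions.\<close>

datatype 'a m2 = M2 (e00: 'a) (e01: 'a) (e10: 'a) (e11: 'a)

instantiation m2 :: (comm_ring_1) ring_1
begin
definition "0 = M2 0 0 0 0"
definition "1 = M2 1 0 0 1"
definition "A + B = M2 (e00 A + e00 B) (e01 A + e01 B) (e10 A + e10 B) (e11 A + e11 B)"
definition "A - B = M2 (e00 A - e00 B) (e01 A - e01 B) (e10 A - e10 B) (e11 A - e11 B)"
definition "- A = M2 (- e00 A) (- e01 A) (- e10 A) (- e11 A)"
definition "A * B = M2 (e00 A * e00 B + e01 A * e10 B) (e00 A * e01 B + e01 A * e11 B)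
  (e10 A * e00 B + e11 A * e10 B) (e10 A * e01 B + e11 A * e11 B)"
instance
  by standard (auto simp: zero_m2_def one_m2_def plus_m2_def minus_m2_def uminus_m2_def
      times_m2_def algebra_simps)
end

lemmas m2_defs = zero_m2_def one_m2_def plus_m2_def minus_m2_def uminus_m2_def times_m2_def

definition sc :: "'a :: comm_ring_1 \<Rightarrow> 'a m2" where
  "sc a = M2 a 0 0 a"

lemma sc_add: "sc (a + b) = sc a + sc b"
  and sc_mult: "sc (a * b) = sc a * sc b"
  and sc_0 [simp]: "sc 0 = 0"
  and sc_1 [simp]: "sc 1 = 1"
  by (simp_all add: sc_def m2_defs)

lemma sc_commute: "A * sc a = sc a * A"
  by (simp add: sc_def m2_defs mult.commute)

lemma sc_left_commute: "A * (sc a * B) = sc a * (A * B)"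
  by (metis mult.assoc sc_commute)

lemma sc_sum: "sc (sum f I) = (\<Sum>i\<in>I. sc (f i))"
  by (induction I rule: infinite_finite_induct) (auto simp: sc_add)

lemma sc_mult_eq_0_iff: "sc (c :: 'a :: idom) * A = 0 \<longleftrightarrow> c = 0 \<or> A = 0"
  by (cases A) (auto simp: sc_def m2_defs)

lemma sc_mult_cancel: "sc (c :: 'a :: idom) * A = sc c * B \<longleftrightarrow> c = 0 \<or> A = B"
  by (cases A; cases B) (auto simp: sc_def m2_defs)

section \<open>Linear recurrences\<close>

text \<open>A linear system with \<open>D\<close> scalar states \<open>q\<close>, constant
  transition \<open>L\<close> and matrix-valued output. Carrying states instead of a recurrence for
  \<open>F\<close> makes products easy: states multiply.\<close>

definition lin_seq :: "nat \<Rightarrow> (nat \<Rightarrow> 'a :: comm_ring_1 m2) \<Rightarrow> bool" where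
  "lin_seq D F \<longleftrightarrow> (\<exists>q L C. (\<forall>s<D. \<forall>n. q s (Suc n) = (\<Sum>t<D. L s t * q t n)) \<and>
     (\<forall>n. F n = (\<Sum>s<D. sc (q s n) * C s)))"

lemma lin_seq_const: "lin_seq 1 (\<lambda>_. Y)"
  unfolding lin_seq_def by (intro exI[of _ "\<lambda>_ _. 1"] exI[of _ "\<lambda>_. Y"]) simp

lemma sum_double: "(\<Sum>t<2 * D. f t) = (\<Sum>s<D. f (2 * s) + f (2 * s + 1))" for D :: nat
  by (induction D) (simp_all add: ac_simps)

lemma sc_combination:
  "sc q * C * ((sc a * X + sc b) * Y) = sc (q * a) * (C * (X * Y)) + sc (q * b) * (C * Y)"
  by (cases C; cases X; cases Y) (simp add: sc_def m2_defs algebra_simps)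

text \<open>By the Cayley-Hamilton theorem \<open>X ^ n\<close> has two scalar states, and their
  products with the states of \<open>F\<close> drive the new sequence. This doubling is the source
  of \<open>2 ^ l\<close>.\<close>

lemma lin_seq_power:
  fixes X Y :: "'a :: comm_ring_1 m2"
  assumes "lin_seq D F"
  shows "lin_seq (2 * D) (\<lambda>n. F n * (X ^ n * Y))"
proof -
  obtain q L C where q: "\<And>s n. s < D \<Longrightarrow> q s (Suc n) = (\<Sum>t<D. L s t * q t n)"
    and F: "\<And>n. F n = (\<Sum>s<D. sc (q s n) * C s)"
    using assms unfolding lin_seq_def by blast
  define tr where "tr = e00 X + e11 X"
  define det where "det = e00 X * e11 X - e01 X * e10 X"
  \<comment> \<open>Multiplying \<open>a X + b\<close> by \<open>X\<close> and substituting
    \<open>X^2 = tr X - det\<close> gives \<open>(tr a + b) X - det a\<close>.\<close>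
  define ab where "ab = rec_nat (0, 1) (\<lambda>_ (a, b). (tr * a + b, - det * a))"
  define a where "a n = fst (ab n)" for n
  define b where "b n = snd (ab n)" for n
  have a: "a 0 = 0" "a (Suc n) = tr * a n + b n" and b: "b 0 = 1" "b (Suc n) = - det * a n" for n
    by (auto simp: a_def b_def ab_def split_beta)
  have Xn: "X ^ n = sc (a n) * X + sc (b n)" for n
  proof (induction n)
    case (Suc n)
    have "X ^ Suc n = (sc (a n) * X + sc (b n)) * X"
      unfolding power_Suc2 Suc ..
    then show ?case
      by (cases X) (simp add: a b tr_def det_def sc_def m2_defs algebra_simps)
  qed (simp add: a b)
  \<comment> \<open>State \<open>2 s\<close> is the product with \<open>a n\<close>, state
    \<open>2 s + 1\<close> the product with \<open>b n\<close>; \<open>k\<close> is the transition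
    matrix of the pair \<open>(a, b)\<close>, and \<open>L'\<close> its Kronecker product with
    \<open>L\<close>.\<close>
  define q' where "q' s n = q (s div 2) n * (if even s then a n else b n)" for s n
  define k where "k s t = (if even s then if even t then tr else 1
    else if even t then - det else 0)" for s t :: nat
  define L' where "L' s t = L (s div 2) (t div 2) * k s t" for s t
  define C' where "C' s = (if even s then C (s div 2) * (X * Y) else C (s div 2) * Y)" for s
  have "q' s (Suc n) = (\<Sum>t<2 * D. L' s t * q' t n)" if "s < 2 * D" for s n
  proof -
    have "s div 2 < D" using that by auto
    then have "q' s (Suc n) =
        (\<Sum>t<D. L (s div 2) t * q t n) * (if even s then a (Suc n) else b (Suc n))"
      by (simp add: q'_def q)
    also have "\<dots> = (\<Sum>t<D. L (s div 2) t * q t n * (k s 0 * a n + k s 1 * b n))"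
      by (simp add: sum_distrib_right k_def a b)
    also have "\<dots> = (\<Sum>t<2 * D. L' s t * q' t n)"
      unfolding sum_double by (intro sum.cong) (auto simp: L'_def q'_def k_def algebra_simps)
    finally show ?thesis .
  qed
  moreover have "F n * (X ^ n * Y) = (\<Sum>s<2 * D. sc (q' s n) * C' s)" for n
  proof -
    have "F n * (X ^ n * Y) = (\<Sum>s<D. sc (q s n) * C s * ((sc (a n) * X + sc (b n)) * Y))"
      by (simp add: F Xn sum_distrib_right)
    also have "\<dots> = (\<Sum>s<2 * D. sc (q' s n) * C' s)"
      unfolding sum_double
      by (intro sum.cong) (simp_all add: q'_def C'_def sc_combination)
    finally show ?thesis .
  qed
  ultimately show ?thesis
    unfolding lin_seq_def by blast
qed

text \<open>The \<open>D + 1\<close> state vectors at times \<open>0..D\<close> live in dimension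
  \<open>D\<close> and are dependent, and the linear evolution carries a dependency to all later
  times. The top coefficient is only made nonzero, not 1, which suffices over an integral domain
  because it can be cancelled.\<close>

lemma lin_seq_dependency:
  fixes F :: "nat \<Rightarrow> 'a :: idom m2"
  assumes "lin_seq D F"
  obtains m c where "m \<le> D" "c m \<noteq> 0" "\<And>j. (\<Sum>i\<le>m. sc (c i) * F (i + j)) = 0"
proof -
  obtain q L C where q: "\<And>s n. s < D \<Longrightarrow> q s (Suc n) = (\<Sum>t<D. L s t * q t n)"
    and F: "\<And>n. F n = (\<Sum>s<D. sc (q s n) * C s)"
    using assms unfolding lin_seq_def by blast
  \<comment> \<open>The columns are the state vectors; the zero row makes the matrix square with
    determinant 0, so that it has a kernel vector.\<close>
  define A where "A = mat (Suc D) (Suc D) (\<lambda>(s, i). if s < D then q s i else 0)"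
  have A: "A \<in> carrier_mat (Suc D) (Suc D)" by (simp add: A_def)
  have "det A = 0"
  proof -
    have "A = mat\<^sub>r (Suc D) (Suc D) (\<lambda>i. if i = D then 0\<^sub>v (Suc D) else row A i)"
      by (rule eq_matI) (auto simp: A_def)
    also have "det \<dots> = 0"
      by (rule det_row_0) (auto simp: A_def)
    finally show ?thesis .
  qed
  then obtain v where v: "v \<in> carrier_vec (Suc D)" "v \<noteq> 0\<^sub>v (Suc D)" "A *\<^sub>v v = 0\<^sub>v (Suc D)"
    using det_0_iff_vec_prod_zero[OF A] by blast
  define c where "c i = v $ i" for i
  have "\<exists>i\<le>D. c i \<noteq> 0"
  proof (rule ccontr)
    assume "\<not> ?thesis"
    then have "v = 0\<^sub>v (Suc D)" using v(1) by (intro eq_vecI) (auto simp: c_def)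
    then show False using v(2) by simp
  qed
  define m where "m = (GREATEST i. i \<le> D \<and> c i \<noteq> 0)"
  have m: "m \<le> D \<and> c m \<noteq> 0"
    unfolding m_def by (rule GreatestI_ex_nat[of _ D]) (use \<open>\<exists>i\<le>D. c i \<noteq> 0\<close> in auto)
  have max: "c i = 0" if "m < i" "i \<le> D" for i
    using Greatest_le_nat[of "\<lambda>i. i \<le> D \<and> c i \<noteq> 0" i D] that unfolding m_def by fastforce
  have 0: "(\<Sum>i\<le>m. c i * q s i) = 0" if "s < D" for s
  proof -
    have "0 = (A *\<^sub>v v) $ s" using v(3) that by simp
    also have "\<dots> = (\<Sum>i\<in>{0..<Suc D}. q s i * c i)"
      using that v(1) by (simp add: A_def scalar_prod_def c_def del: sum.op_ivl_Suc)
    also have "\<dots> = (\<Sum>i\<le>m. q s i * c i)"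
      using m max by (intro sum.mono_neutral_right) auto
    finally show ?thesis by (simp add: mult.commute)
  qed
  have shift: "\<forall>s<D. (\<Sum>i\<le>m. c i * q s (i + j)) = 0" for j
  proof (induction j)
    case (Suc j)
    show ?case
    proof (intro allI impI)
      fix s assume s: "s < D"
      have "(\<Sum>i\<le>m. c i * q s (i + Suc j)) = (\<Sum>i\<le>m. \<Sum>t<D. L s t * (c i * q t (i + j)))"
        using s by (simp add: q sum_distrib_left algebra_simps)
      also have "\<dots> = (\<Sum>t<D. L s t * (\<Sum>i\<le>m. c i * q t (i + j)))"
        by (subst sum.swap) (simp add: sum_distrib_left)
      also have "\<dots> = 0" using Suc by simp
      finally show "(\<Sum>i\<le>m. c i * q s (i + Suc j)) = 0" .
    qed
  qed (simp add: 0)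
  have "(\<Sum>i\<le>m. sc (c i) * F (i + j)) = 0" for j
  proof -
    have "(\<Sum>i\<le>m. sc (c i) * F (i + j)) = (\<Sum>i\<le>m. \<Sum>s<D. sc (c i * q s (i + j)) * C s)"
      by (simp add: F sum_distrib_left sc_mult mult.assoc)
    also have "\<dots> = (\<Sum>s<D. sc (\<Sum>i\<le>m. c i * q s (i + j)) * C s)"
      by (subst sum.swap) (simp add: sc_sum sum_distrib_right)
    also have "\<dots> = 0" using shift by simp
    finally show ?thesis .
  qed
  then show ?thesis using that[of m c] m by blast
qed

text \<open>The deviation \<open>G\<close> from growth with ratio \<open>r\<close> obeys the same
  recurrence and vanishes at its first \<open>m \<le> D\<close> arguments; as \<open>G n\<close>
  involves \<open>F (Suc n)\<close>, this takes the \<open>D + 1\<close> initial values of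
  \<open>F\<close>. Cancelling \<open>c m\<close> propagates the vanishing.\<close>

lemma lin_seq_geometric:
  fixes F :: "nat \<Rightarrow> 'a :: idom m2"
  assumes "lin_seq D F" and init: "\<And>n. n \<le> D \<Longrightarrow> F n = sc (\<kappa> * r ^ n)"
  shows "F n = sc (\<kappa> * r ^ n)"
proof -
  define G where "G n = F (Suc n) - sc r * F n" for n
  obtain m c where m: "m \<le> D" "c m \<noteq> 0" and rec: "\<And>j. (\<Sum>i\<le>m. sc (c i) * F (i + j)) = 0"
    using lin_seq_dependency[OF assms(1)] by metis
  have recG: "(\<Sum>i\<le>m. sc (c i) * G (i + j)) = 0" for j
  proof -
    have "(\<Sum>i\<le>m. sc (c i) * G (i + j)) =
        (\<Sum>i\<le>m. sc (c i) * F (i + Suc j)) - sc r * (\<Sum>i\<le>m. sc (c i) * F (i + j))"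
      by (simp add: G_def sum_subtractf sum_distrib_left right_diff_distrib sc_left_commute[where a = r])
    then show ?thesis using rec[of j] rec[of "Suc j"] by simp
  qed
  have "G n = 0" for n
  proof (induction n rule: less_induct)
    case (less n)
    show ?case
    proof (cases "n < m")
      case True
      then show ?thesis using init[of n] init[of "Suc n"] m(1)
        by (simp add: G_def flip: sc_mult) (simp add: ac_simps)
    next
      case False
      then obtain j where j: "n = m + j" by (metis le_iff_add not_less)
      have "(\<Sum>i<m. sc (c i) * G (i + j)) = 0"
        using less.IH j by (intro sum.neutral) auto
      then have "sc (c m) * G n = 0"
        using recG[of j] by (simp add: j flip: lessThan_Suc_atMost)
      then show ?thesis using m(2) by (simp add: sc_mult_eq_0_iff)
    qed
  qed
  then have step: "F (Suc n) = sc r * F n" for n by (simp add: G_def)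
  show ?thesis
  proof (induction n)
    case (Suc n)
    then show ?case by (simp add: step flip: sc_mult) (simp add: ac_simps)
  qed (simp add: init)
qed

section \<open>A faithful representation\<close>

text \<open>A letter \<open>a\<close> acts as \<open>X\<^sup>2 E + E'\<close>, where \<open>E\<close> and \<open>E'\<close> are the projections onto the lines
  through \<open>(1, pt a)\<close> and \<open>(1, pt (flip a))\<close> along each other. Along a reduced word the
  projections never annihilate each other, so the top coefficient survives.\<close>

definition pt :: "nat \<times> bool \<Rightarrow> int" where
  "pt a = 2 * int (fst a) + (if snd a then 0 else 1)"

text \<open>Since \<open>pt a\<close> and \<open>pt (flip a)\<close> differ by 1, \<open>s\<close>
  is its own inverse, and dividing by it in the formula for the projection leaves integer
  entries.\<close>

definition proj :: "nat \<times> bool \<Rightarrow> int m2" where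
  "proj a = (let p = pt a; q = pt (flip a); s = p - q in M2 (- s * q) s (- s * p * q) (s * p))"

definition const_m2 :: "int m2 \<Rightarrow> int poly m2" where
  "const_m2 A = M2 [:e00 A:] [:e01 A:] [:e10 A:] [:e11 A:]"

text \<open>This is \<open>X\<close> times a matrix with eigenvalues \<open>X\<close> and
  \<open>1 / X\<close>. The scaling keeps the entries polynomial, at the price that
  \<open>rho\<close> respects cancellation only up to powers of \<open>X^2\<close>.\<close>

definition rho1 :: "nat \<times> bool \<Rightarrow> int poly m2" where
  "rho1 a = sc (monom 1 2) * const_m2 (proj a) + const_m2 (proj (flip a))"

definition rho :: "nat word \<Rightarrow> int poly m2" where
  "rho u = prod_list (map rho1 u)"

lemma proj_simps:
  "proj a * proj a = proj a" "proj a * proj (flip a) = 0" "proj a + proj (flip a) = 1"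
  by (simp_all add: proj_def pt_def flip_def m2_defs Let_def algebra_simps)

lemma const_m2_mult: "const_m2 (A * B) = const_m2 A * const_m2 B"
  and const_m2_add: "const_m2 (A + B) = const_m2 A + const_m2 B"
  and const_m2_0 [simp]: "const_m2 0 = 0"
  and const_m2_1 [simp]: "const_m2 1 = 1"
  by (simp_all add: const_m2_def m2_defs one_pCons)

lemma rho1_flip: "rho1 a * rho1 (flip a) = sc (monom 1 2)"
proof -
  let ?x = "sc (monom (1::int) 2)" and ?E = "const_m2 (proj a)" and ?E' = "const_m2 (proj (flip a))"
  have *: "?E * ?E = ?E" "?E' * ?E' = ?E'" "?E * ?E' = 0" "?E' * ?E = 0" "?E + ?E' = 1"
    using proj_simps[of a] proj_simps[of "flip a"]
    by (simp_all flip: const_m2_mult const_m2_add)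
  have "rho1 a * rho1 (flip a) =
      (?x * ?E) * (?x * ?E') + ?x * (?E * ?E) + ?E' * (?x * ?E') + ?E' * ?E"
    by (simp add: rho1_def distrib_left distrib_right mult.assoc)
  also have "(?x * ?E) * (?x * ?E') = ?x * ?x * (?E * ?E')"
    by (simp only: mult.assoc sc_left_commute[of ?E])
  also have "?E' * (?x * ?E') = ?x * (?E' * ?E')"
    by (rule sc_left_commute)
  also have "?x * ?x * (?E * ?E') + ?x * (?E * ?E) + ?x * (?E' * ?E') + ?E' * ?E = ?x * (?E + ?E')"
    by (simp add: * distrib_left del: *(5))
  finally show ?thesis by (simp add: *)
qed

lemma rho_Nil [simp]: "rho [] = 1"
  and rho_append: "rho (u @ v) = rho u * rho v"
  and rho_Cons: "rho (a # u) = rho1 a * rho u"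
  by (simp_all add: rho_def)

text \<open>A cancelled pair contributes \<open>X^2\<close>, one factor \<open>X\<close> for each
  letter. Multiplying crosswise avoids negative powers; in the transitive case the power belonging
  to the middle word is cancelled.\<close>

lemma rho_free_cong:
  "(u, v) \<in> free_cong X \<Longrightarrow>
    sc (monom 1 (length v)) * rho u = sc (monom 1 (length u)) * rho v"
proof (induction rule: free_cong.induct)
  case (cancel u v x b)
  have flip: "rho1 (x, b) * rho1 (x, \<not> b) = sc (monom 1 2)"
    using rho1_flip[of "(x, b)"] by (simp add: flip_def)
  have "rho1 (x, b) * (rho1 (x, \<not> b) * rho v) = sc (monom 1 2) * rho v"
    by (simp add: flip flip: mult.assoc)
  then have "rho (u @ [(x, b), (x, \<not> b)] @ v) = sc (monom 1 2) * rho (u @ v)"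
    by (simp add: rho_append rho_Cons sc_left_commute[of "rho u"])
  then show ?case by (simp add: mult_monom flip: sc_mult mult.assoc)
next
  case (trans u v w)
  let ?x = "\<lambda>u :: nat word. sc (monom (1::int) (length u))"
  have "?x v * (?x w * rho u) = ?x w * (?x v * rho u)" by (rule sc_left_commute)
  also have "\<dots> = ?x w * (?x u * rho v)" by (simp only: trans.IH(1))
  also have "\<dots> = ?x u * (?x w * rho v)" by (rule sc_left_commute)
  also have "\<dots> = ?x u * (?x v * rho w)" by (simp only: trans.IH(2))
  also have "\<dots> = ?x v * (?x u * rho w)" by (rule sc_left_commute)
  finally show ?case by (simp add: sc_mult_cancel)
qed auto

lemma coeff_rho1_mult:
  "coeff (e01 (rho1 a * N)) k =
     (if k < 2 then 0 else e00 (proj a) * coeff (e01 N) (k - 2) + e01 (proj a) * coeff (e11 N) (k - 2)) +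
     (e00 (proj (flip a)) * coeff (e01 N) k + e01 (proj (flip a)) * coeff (e11 N) k)"
  "coeff (e11 (rho1 a * N)) k =
     (if k < 2 then 0 else e10 (proj a) * coeff (e01 N) (k - 2) + e11 (proj a) * coeff (e11 N) (k - 2)) +
     (e10 (proj (flip a)) * coeff (e01 N) k + e11 (proj (flip a)) * coeff (e11 N) k)"
  by (simp_all add: rho1_def const_m2_def sc_def times_m2_def plus_m2_def distrib_right mult.assoc
      coeff_monom_mult)

text \<open>The second column is followed: its top coefficient is a multiple of
  \<open>(1, pt a)\<close>. Prepending \<open>a\<close> to a word that starts with \<open>b\<close>
  applies \<open>proj a\<close> to \<open>(1, pt b)\<close>, which yields \<open>(1, pt a)\<close>
  times the difference \<open>pt b - pt (flip a)\<close> up to sign, and this is nonzero because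
  \<open>b \<noteq> flip a\<close>.\<close>

lemma rho_reduced:
  assumes "reduced (a # u)"
  shows "\<exists>\<beta>\<noteq>0. coeff (e01 (rho (a # u))) (2 * Suc (length u)) = \<beta> \<and>
    coeff (e11 (rho (a # u))) (2 * Suc (length u)) = pt a * \<beta> \<and>
    (\<forall>k>2 * Suc (length u). coeff (e01 (rho (a # u))) k = 0 \<and> coeff (e11 (rho (a # u))) k = 0)"
  using assms
proof (induction u arbitrary: a)
  case Nil
  have "pt a - pt (flip a) \<noteq> 0" by (auto simp: pt_def flip_def)
  moreover have "coeff (e01 1) k = (0::int)" "coeff (e11 1) k = (if k = 0 then 1 else 0 :: int)" for k
    by (simp_all add: one_m2_def)
  ultimately show ?case
    unfolding rho_Cons coeff_rho1_mult
    by (intro exI[of _ "pt a - pt (flip a)"]) (simp add: proj_def Let_def)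
next
  case (Cons b u)
  then have "reduced (b # u)" by simp
  from Cons.IH[OF this] obtain \<beta> where \<beta>: "\<beta> \<noteq> 0"
    "coeff (e01 (rho (b # u))) (2 * Suc (length u)) = \<beta>"
    "coeff (e11 (rho (b # u))) (2 * Suc (length u)) = pt b * \<beta>"
    "\<forall>k>2 * Suc (length u). coeff (e01 (rho (b # u))) k = 0 \<and> coeff (e11 (rho (b # u))) k = 0"
    by (elim exE conjE)
  define N where "N = rho (b # u)"
  define n where "n = 2 * Suc (length u)"
  have rho: "rho (a # b # u) = rho1 a * N" by (simp add: N_def rho_Cons)
  have N: "coeff (e01 N) n = \<beta>" "coeff (e11 N) n = pt b * \<beta>"
    "\<And>k. k > n \<Longrightarrow> coeff (e01 N) k = 0" "\<And>k. k > n \<Longrightarrow> coeff (e11 N) k = 0"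
    using \<beta> by (auto simp: N_def n_def)
  have ne: "pt a \<noteq> pt (flip a)" "pt b \<noteq> pt (flip a)"
  proof -
    show "pt a \<noteq> pt (flip a)" by (simp add: pt_def flip_def)
    have "b \<noteq> flip a" using Cons.prems by simp
    then show "pt b \<noteq> pt (flip a)"
      unfolding pt_def flip_def prod_eq_iff by (cases "snd a"; cases "snd b") (simp_all, presburger+)
  qed
  have n2: "2 * Suc (length (b # u)) = n + 2" by (simp add: n_def)
  show ?case
    unfolding n2 rho coeff_rho1_mult
  proof (intro exI[of _ "(pt a - pt (flip a)) * (pt b - pt (flip a)) * \<beta>"] conjI allI impI)
    show "(pt a - pt (flip a)) * (pt b - pt (flip a)) * \<beta> \<noteq> 0"
      using ne \<beta>(1) by simp
  qed (use N in \<open>auto simp: proj_def Let_def algebra_simps\<close>)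
qed

text \<open>If the reduced form is not empty, \<open>rho_reduced\<close> gives its matrix a nonzero
  off-diagonal entry, which a scalar matrix cannot have.\<close>

lemma fequiv_Nil_iff_rho:
  fixes u :: "nat word"
  shows "u \<approx> [] \<longleftrightarrow> rho u = sc (monom 1 (length u))"
proof
  assume "u \<approx> []"
  from rho_free_cong[OF this] show "rho u = sc (monom 1 (length u))"
    by (simp add: monom_0 flip: one_pCons)
next
  assume *: "rho u = sc (monom 1 (length u))"
  have "sc (monom 1 (length (red u))) * rho u = sc (monom 1 (length u)) * rho (red u)"
    by (rule rho_free_cong[OF fequiv_red])
  then have "sc (monom 1 (length u)) * sc (monom 1 (length (red u))) = sc (monom 1 (length u)) * rho (red u)"
    by (simp only: * sc_commute[of "sc (monom 1 (length u))"])
  then have eq: "rho (red u) = sc (monom 1 (length (red u)))"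
    by (simp add: sc_mult_cancel)
  have "red u = []"
  proof (rule ccontr)
    assume "red u \<noteq> []"
    then obtain a v where v: "red u = a # v" by (cases "red u") auto
    then have "e01 (rho (a # v)) \<noteq> 0"
      using rho_reduced[of a v] reduced_red[of u] by force
    then show False using eq v by (simp add: sc_def)
  qed
  then show "u \<approx> []" by (simp add: fequiv_Nil_iff)
qed

lemma rho_replicate: "rho (concat (replicate n x)) = rho x ^ n"
  by (induction n) (simp_all add: rho_append)

text \<open>Triviality of \<open>V n\<close> means that its matrix is \<open>X\<close> to the power
  \<open>length (V n)\<close>, and this length is affine in \<open>n\<close>. The claim is thus that
  a linear sequence is geometric, which its first \<open>2 ^ length xys + 1\<close> values
  decide.\<close>

lemma trivial_progression:
  fixes y :: "nat word" and xys :: "(nat word \<times> nat word) list"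
  defines "V n \<equiv> y @ concat (map (\<lambda>(x, y). concat (replicate n x) @ y) xys)"
  assumes "\<And>n. n \<le> 2 ^ length xys \<Longrightarrow> V n \<approx> []"
  shows "V n \<approx> []"
proof -
  define \<alpha> where "\<alpha> = length y + (\<Sum>(x, y)\<leftarrow>xys. length y)"
  define \<beta> where "\<beta> = (\<Sum>(x, y)\<leftarrow>xys. length x)"
  have len: "length (V n) = \<alpha> + \<beta> * n" for n
  proof -
    have "length (concat (map (\<lambda>(x, y). concat (replicate n x) @ y) xys)) =
        (\<Sum>(x, y)\<leftarrow>xys. length y) + (\<Sum>(x, y)\<leftarrow>xys. length x) * n"
      by (induction xys) (auto simp: length_concat sum_list_replicate algebra_simps)
    then show ?thesis by (simp add: V_def \<alpha>_def \<beta>_def)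
  qed
  have "lin_seq (2 ^ length xys)
      (\<lambda>n. rho (y @ concat (map (\<lambda>(x, y). concat (replicate n x) @ y) xys)))"
  proof (induction xys rule: rev_induct)
    case Nil
    then show ?case using lin_seq_const by simp
  next
    case (snoc xy xys)
    obtain x z where xy: "xy = (x, z)" by (cases xy)
    show ?case
      using lin_seq_power[OF snoc, of "rho x" "rho z"]
      by (simp add: xy rho_append rho_replicate mult.assoc)
  qed
  then have lin: "lin_seq (2 ^ length xys) (\<lambda>n. rho (V n))" by (simp add: V_def)
  have mon: "monom 1 (length (V n)) = monom 1 \<alpha> * monom (1::int) \<beta> ^ n" for n
    by (simp add: len monom_power mult_monom)
  have "rho (V n) = sc (monom 1 \<alpha> * monom 1 \<beta> ^ n)"
  proof (rule lin_seq_geometric[OF lin])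
    fix n :: nat assume "n \<le> 2 ^ length xys"
    from assms(2)[OF this] show "rho (V n) = sc (monom 1 \<alpha> * monom 1 \<beta> ^ n)"
      by (simp add: fequiv_Nil_iff_rho mon)
  qed
  then show ?thesis by (simp add: fequiv_Nil_iff_rho mon)
qed

section \<open>Exponent products as words\<close>

definition npw :: "'a word \<Rightarrow> nat \<Rightarrow> 'a word" where
  "npw t n = concat (replicate n t)"

definition pw :: "'a word \<Rightarrow> int \<Rightarrow> 'a word" where
  "pw t k = npw t (nat k) @ npw (inv_word t) (nat (- k))"

definition exp_word :: "'a word list \<Rightarrow> 'a word list \<Rightarrow> (nat \<Rightarrow> int) \<Rightarrow> 'a word" where
  "exp_word ws ts k = ws ! 0 @ concat (map (\<lambda>i. pw (ts ! i) (k i) @ ws ! Suc i) [0..<length ts])"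

lemma npw_0 [simp]: "npw t 0 = []"
  and npw_Suc: "npw t (Suc n) = t @ npw t n"
  and length_npw [simp]: "length (npw t n) = n * length t"
  by (simp_all add: npw_def length_concat sum_list_replicate)

lemma npw_Suc2: "npw t (Suc n) = npw t n @ t"
  by (induction n) (simp_all add: npw_Suc)

lemma words_npw: "t \<in> words X \<Longrightarrow> npw t n \<in> words X"
  by (induction n) (simp_all add: npw_Suc)

lemma words_pw: "t \<in> words X \<Longrightarrow> pw t k \<in> words X"
  by (simp add: pw_def words_npw)

lemma inv_word_npw: "inv_word (npw t n) = npw (inv_word t) n"
  by (induction n) (simp_all add: npw_Suc2[of "inv_word t"] npw_Suc[of t])

lemma word_class_npw:
  "t \<in> words X \<Longrightarrow> word_class X t [^]\<^bsub>free_group X\<^esub> n = word_class X (npw t n)"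
  by (induction n) (simp_all add: one_free_group mult_free_group words_npw npw_Suc2)

lemma word_class_carrier: "u \<in> words X \<Longrightarrow> word_class X u \<in> carrier (free_group X)"
  by (simp add: carrier_free_group)

lemma inv_word_class:
  assumes "u \<in> words X"
  shows "inv\<^bsub>free_group X\<^esub> word_class X u = word_class X (inv_word u)"
proof (rule group.inv_equality[OF group_free_group])
  have u: "inv_word u \<in> words X" using assms by (rule inv_word_words)
  have "word_class X (inv_word u @ u) = word_class X []"
    using assms by (simp add: word_class_eq_iff inv_word_cancel)
  then show "word_class X (inv_word u) \<otimes>\<^bsub>free_group X\<^esub> word_class X u = \<one>\<^bsub>free_group X\<^esub>"
    unfolding mult_free_group[OF u assms] one_free_group .
  show "word_class X u \<in> carrier (free_group X)" "word_class X (inv_word u) \<in> carrier (free_group X)"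
    using u assms by (auto intro: word_class_carrier)
qed

lemma word_class_pw:
  assumes "t \<in> words X"
  shows "word_class X t [^]\<^bsub>free_group X\<^esub> (k :: int) = word_class X (pw t k)"
proof (cases "k < 0")
  case True
  then have "pw t k = inv_word (npw t (nat (- k)))" by (simp add: pw_def inv_word_npw)
  then show ?thesis
    using True inv_word_class[OF words_npw[OF assms, of "nat (- k)"]]
    by (simp only: int_pow_def2 word_class_npw[OF assms] if_True)
next
  case False
  then have "pw t k = npw t (nat k)" by (simp add: pw_def)
  then show ?thesis using False by (simp only: int_pow_def2 word_class_npw[OF assms] if_False)
qed

lemma fequiv_iff_word_class: "u \<approx> v \<longleftrightarrow> word_class UNIV u = word_class UNIV v"
  by (simp add: word_class_eq_iff)

lemma fequiv_pw_add: "pw t (a + b) \<approx> pw t a @ pw t b"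
proof -
  have "word_class UNIV t \<in> carrier (free_group UNIV)" by (simp add: carrier_free_group)
  from group.int_pow_mult[OF group_free_group this, of a b] have "word_class UNIV (pw t (a + b)) = word_class UNIV (pw t a @ pw t b)"
    by (simp add: word_class_pw mult_free_group)
  then show ?thesis by (simp add: fequiv_iff_word_class)
qed

lemma fequiv_pw_mult: "pw t (int n * a) \<approx> npw (pw t a) n"
proof (induction n)
  case (Suc n)
  have "pw t (a + int n * a) \<approx> pw t a @ npw (pw t a) n"
    by (rule free_cong.trans[OF fequiv_pw_add fequiv_append[OF fequiv_refl Suc]])
  then show ?case by (simp add: npw_Suc distrib_right)
next
  case 0
  show ?case by (simp add: pw_def)
qed

lemma fequiv_pw_diff: "npw t p @ npw (inv_word t) q \<approx> pw t (int p - int q)"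
proof -
  have "pw t (int p + - int q) \<approx> pw t (int p) @ pw t (- int q)" by (rule fequiv_pw_add)
  then show ?thesis by (simp add: pw_def free_cong.sym)
qed

lemma exp_word_words:
  assumes "set ws \<subseteq> words X" "set ts \<subseteq> words X" "length ws = Suc (length ts)"
  shows "exp_word ws ts k \<in> words X"
proof -
  have "concat (map (\<lambda>i. pw (ts ! i) (k i) @ ws ! Suc i) is) \<in> words X"
    if "set is \<subseteq> {..<length ts}" for "is"
    using that assms by (induction "is") (auto simp: words_pw subset_iff)
  moreover have "ws ! 0 \<in> words X" using assms by (auto simp: subset_iff)
  ultimately show ?thesis by (simp add: exp_word_def atLeast0LessThan)
qed

lemma exp_product_free_group:
  assumes "set ws \<subseteq> words X" "set ts \<subseteq> words X" "length ws = Suc (length ts)"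
  shows "exp_product (free_group X) (map (word_class X) ws) (map (word_class X) ts) k =
    word_class X (exp_word ws ts (\<lambda>i. k $ i))"
proof -
  have w: "ws ! i \<in> words X" if "i \<le> length ts" for i using that assms by (auto simp: subset_iff)
  have t: "ts ! i \<in> words X" if "i < length ts" for i using that assms by (auto simp: subset_iff)
  have "n \<le> length ts \<Longrightarrow>
    foldl (\<lambda>a i. a \<otimes>\<^bsub>free_group X\<^esub> (map (word_class X) ts ! i [^]\<^bsub>free_group X\<^esub> (k $ i))
        \<otimes>\<^bsub>free_group X\<^esub> (map (word_class X) ws ! Suc i)) (map (word_class X) ws ! 0) [0..<n] =
      word_class X (ws ! 0 @ concat (map (\<lambda>i. pw (ts ! i) (k $ i) @ ws ! Suc i) [0..<n])) \<and>
    ws ! 0 @ concat (map (\<lambda>i. pw (ts ! i) (k $ i) @ ws ! Suc i) [0..<n]) \<in> words X" for n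
  proof (induction n)
    case 0
    then show ?case using assms(3) w[of 0] by simp
  next
    case (Suc n)
    then show ?case
      using assms(3) w[of "Suc n"] t[of n]
      by (auto simp: word_class_pw mult_free_group words_pw simp flip: append_assoc)
  qed
  from this[of "length ts"] show ?thesis by (simp add: exp_product_def exp_word_def)
qed

lemma exp_solutions_free_group:
  assumes "set ws \<subseteq> words X" "set ts \<subseteq> words X" "length ws = Suc (length ts)"
  shows "exp_solutions (free_group X) (map (word_class X) ws) (map (word_class X) ts) =
    {k \<in> carrier_vec (length ts). exp_word ws ts (\<lambda>i. k $ i) \<approx> []}"
  unfolding exp_solutions_def exp_product_free_group[OF assms] one_free_group
  using exp_word_words[OF assms]
  by (auto simp: word_class_eq_iff free_cong_Nil_iff)

lemma fequiv_concat: "(\<And>i. i \<in> set is \<Longrightarrow> f i \<approx> g i) \<Longrightarrow> concat (map f is) \<approx> concat (map g is)"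
  by (induction "is") (auto intro: fequiv_append)

lemma exp_word_cong: "(\<And>i. i < length ts \<Longrightarrow> k i = k' i) \<Longrightarrow> exp_word ws ts k = exp_word ws ts k'"
  by (auto simp: exp_word_def intro!: arg_cong[where f = concat])

section \<open>Verifying linear sets on finitely many points\<close>

text \<open>Rewriting \<open>t^(b + n c)\<close> as \<open>(t^c)^n t^b\<close> puts the product into
  the form of \<open>trivial_progression\<close>, with one \<open>n\<close>-th power for each
  base.\<close>

lemma exp_word_progression:
  fixes ws ts :: "nat word list"
  assumes "\<And>n. n \<le> 2 ^ length ts \<Longrightarrow> exp_word ws ts (\<lambda>i. b i + int n * c i) \<approx> []"
  shows "exp_word ws ts (\<lambda>i. b i + int n * c i) \<approx> []"
proof -
  define xys where "xys = map (\<lambda>i. (pw (ts ! i) (c i), pw (ts ! i) (b i) @ ws ! Suc i)) [0..<length ts]"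
  define V where "V n = ws ! 0 @ concat (map (\<lambda>(x, y). concat (replicate n x) @ y) xys)" for n
  have V: "exp_word ws ts (\<lambda>i. b i + int n * c i) \<approx> V n" for n
  proof -
    have "pw (ts ! i) (b i + int n * c i) \<approx> npw (pw (ts ! i) (c i)) n @ pw (ts ! i) (b i)" for i
      using fequiv_pw_add[of "ts ! i" "int n * c i" "b i"]
        fequiv_append[OF fequiv_pw_mult[of "ts ! i" n "c i"] fequiv_refl[of "pw (ts ! i) (b i)"]]
      by (auto simp: add.commute intro: free_cong.trans)
    from fequiv_append[OF this fequiv_refl]
    have "pw (ts ! i) (b i + int n * c i) @ ws ! Suc i \<approx>
        concat (replicate n (pw (ts ! i) (c i))) @ pw (ts ! i) (b i) @ ws ! Suc i" for i
      by (simp add: npw_def)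
    then show ?thesis
      unfolding exp_word_def V_def xys_def map_map comp_def prod.case
      by (intro fequiv_append[OF fequiv_refl fequiv_concat])
  qed
  have "V n \<approx> []"
    unfolding V_def
  proof (rule trivial_progression)
    fix n :: nat assume "n \<le> 2 ^ length xys"
    then have "exp_word ws ts (\<lambda>i. b i + int n * c i) \<approx> []" by (intro assms) (simp add: xys_def)
    with V[of n] show "ws ! 0 @ concat (map (\<lambda>(x, y). concat (replicate n x) @ y) xys) \<approx> []"
      unfolding V_def by (blast intro: free_cong.trans free_cong.sym)
  qed
  with V[of n] show ?thesis by (rule free_cong.trans)
qed

lemma exp_word_linear:
  fixes ws ts :: "nat word list" and d :: nat
  assumes test: "\<And>v. (\<And>j. j < d \<Longrightarrow> v j \<le> 2 ^ length ts) \<Longrightarrow>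
    exp_word ws ts (\<lambda>i. z i + (\<Sum>j<d. M i j * int (v j))) \<approx> []"
  shows "exp_word ws ts (\<lambda>i. z i + (\<Sum>j<d. M i j * int (v j))) \<approx> []"
proof -
  \<comment> \<open>The parameters below \<open>m\<close> are already arbitrary, the others still
    confined to the test box. The induction step releases parameter \<open>m\<close> by moving along
    a line.\<close>
  have "m \<le> d \<Longrightarrow> (\<forall>j. m \<le> j \<longrightarrow> j < d \<longrightarrow> v j \<le> 2 ^ length ts) \<Longrightarrow>
    exp_word ws ts (\<lambda>i. z i + (\<Sum>j<d. M i j * int (v j))) \<approx> []" for m :: nat and v
  proof (induction m arbitrary: v)
    case (Suc m)
    define b where "b i = z i + (\<Sum>j<d. M i j * int ((v(m := 0)) j))" for i
    have eq: "z i + (\<Sum>j<d. M i j * int ((v(m := n)) j)) = b i + int n * M i m" for i n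
    proof -
      have m: "m \<in> {..<d}" using Suc.prems by simp
      show ?thesis by (simp add: b_def sum.remove[OF _ m] mult.commute)
    qed
    have "exp_word ws ts (\<lambda>i. b i + int n * M i m) \<approx> []" for n
    proof (rule exp_word_progression)
      fix n :: nat assume "n \<le> 2 ^ length ts"
      then have "exp_word ws ts (\<lambda>i. z i + (\<Sum>j<d. M i j * int ((v(m := n)) j))) \<approx> []"
        using Suc.prems by (intro Suc.IH) auto
      then show "exp_word ws ts (\<lambda>i. b i + int n * M i m) \<approx> []"
        unfolding eq .
    qed
    from this[of "v m"] show ?case unfolding eq[of _ "v m", symmetric] by simp
  qed (use test in auto)
  from this[of d v] show ?thesis by simp
qed

section \<open>Every solution lies in a small linear set\<close>

lemma cyclic_reduction_aux:
  "reduced t \<Longrightarrow> \<exists>u s. t = u @ s @ inv_word u \<and> (s \<noteq> [] \<longrightarrow> hd s \<noteq> flip (last s))"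
proof (induction "length t" arbitrary: t rule: less_induct)
  case less
  show ?case
  proof (cases "t \<noteq> [] \<and> hd t = flip (last t)")
    case True
    then obtain a t' where t': "t = a # t'" by (cases t) auto
    with True have "t' \<noteq> []" by auto
    then obtain m b where m: "t' = m @ [b]" by (cases t' rule: rev_cases) auto
    have t: "t = a # m @ [flip a]" using True t' m by simp
    then have "reduced m"
      using less.prems reduced_append[of "[a]" "m @ [flip a]"] by (simp add: reduced_append)
    then obtain u s where "m = u @ s @ inv_word u" "s \<noteq> [] \<longrightarrow> hd s \<noteq> flip (last s)"
      using less.hyps[of m] t by auto
    then show ?thesis using t by (intro exI[of _ "a # u"] exI[of _ s]) simp
  next
    case False
    then have "t = [] @ t @ inv_word [] \<and> (t \<noteq> [] \<longrightarrow> hd t \<noteq> flip (last t))" by auto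
    then show ?thesis by blast
  qed
qed

lemma cyclic_reduction:
  obtains u s where "t \<approx> u @ s @ inv_word u" "reduced s" "s \<noteq> [] \<longrightarrow> hd s \<noteq> flip (last s)"
    "length s \<le> length t" "length u \<le> length t"
proof -
  obtain u s where us: "red t = u @ s @ inv_word u" "s \<noteq> [] \<longrightarrow> hd s \<noteq> flip (last s)"
    using cyclic_reduction_aux[OF reduced_red] by blast
  moreover have "reduced s" using reduced_red[of t] unfolding us(1) by (simp add: reduced_append)
  moreover have "length (red t) \<le> length t" by (rule length_red)
  ultimately show ?thesis using that[of u s] fequiv_red[of t] by simp
qed

text \<open>This is the purpose of cyclic reduction: diagrams are built from reduced factors, and a
  power is reduced only if nothing cancels where two copies meet.\<close>

lemma reduced_npw:
  assumes "reduced s" "s \<noteq> [] \<longrightarrow> hd s \<noteq> flip (last s)"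
  shows "reduced (npw s n)"
proof (cases "s = []")
  case False
  have "reduced (npw s n) \<and> (npw s n \<noteq> [] \<longrightarrow> hd (npw s n) = hd s)"
    using assms False by (induction n) (auto simp: npw_Suc reduced_append)
  then show ?thesis by blast
qed (simp add: npw_def)

lemma fequiv_npw_conj:
  assumes "t \<approx> u @ s @ inv_word u"
  shows "npw t n \<approx> u @ npw s n @ inv_word u"
proof (induction n)
  case 0
  show ?case using fequiv_inv_right free_cong.sym by force
next
  case (Suc n)
  have "t @ npw t n \<approx> (u @ s @ inv_word u) @ u @ npw s n @ inv_word u"
    by (rule fequiv_append[OF assms Suc])
  also have "(u @ s @ inv_word u) @ u @ npw s n @ inv_word u = (u @ s) @ inv_word u @ u @ npw s n @ inv_word u"
    by simp
  finally have "t @ npw t n \<approx> (u @ s) @ npw s n @ inv_word u"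
    using fequiv_cancel_left free_cong.trans by blast
  then show ?case by (simp add: npw_Suc)
qed

text \<open>The constant factors absorb the conjugators, so their lengths become at most
  \<open>3 N\<close> when all words involved have length at most \<open>N\<close>. The trailing
  \<open>u m\<close> carries the induction and is empty in the application.\<close>

lemma fequiv_regroup:
  fixes u w y :: "nat \<Rightarrow> 'a word"
  defines "w' \<equiv> \<lambda>i. red (if i = 0 then w 0 @ u 0 else inv_word (u (i - 1)) @ w i @ u i)"
  shows "w 0 @ concat (map (\<lambda>i. u i @ y i @ inv_word (u i) @ w (Suc i)) [0..<m]) @ u m \<approx>
    w' 0 @ concat (map (\<lambda>i. y i @ w' (Suc i)) [0..<m])"
proof (induction m)
  case 0
  show ?case using fequiv_red[of "w 0 @ u 0"] by (simp add: w'_def)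
next
  case (Suc m)
  let ?L = "w 0 @ concat (map (\<lambda>i. u i @ y i @ inv_word (u i) @ w (Suc i)) [0..<m])"
  let ?R = "w' 0 @ concat (map (\<lambda>i. y i @ w' (Suc i)) [0..<m])"
  have "inv_word (u m) @ w (Suc m) @ u (Suc m) \<approx> w' (Suc m)"
    using fequiv_red by (simp add: w'_def)
  moreover have "?L @ u m \<approx> ?R" using Suc by simp
  ultimately have "(?L @ u m) @ y m @ inv_word (u m) @ w (Suc m) @ u (Suc m) \<approx> ?R @ y m @ w' (Suc m)"
    by (rule fequiv_append[OF _ fequiv_append[OF fequiv_refl], rotated])
  then show ?case by simp
qed

text \<open>For the empty word the sequence is constant, hence periodic with every period, and an
  empty side reads none of it.\<close>

definition per :: "'a word \<Rightarrow> nat \<Rightarrow> 'a \<times> bool" where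
  "per w j = (if w = [] then undefined else w ! (j mod length w))"

lemma seg_per: "seg (per w, n * length w) = npw w n"
proof (induction n)
  case (Suc n)
  have "shift (n * length w) (per w) = per w"
    by (auto simp: shift_def per_def)
  moreover have "seg (per w, length w) = w"
    by (rule nth_equalityI) (auto simp: seg_def per_def)
  ultimately show ?case
    using seg_add[of "per w" "n * length w" "length w"] Suc by (simp add: npw_Suc2 add.commute)
qed simp

lemma seg_per_1: "seg (per w, length w) = w"
  using seg_per[of w 1] by (simp add: npw_def)

lemma periodic_per: "length w dvd P \<or> w = [] \<Longrightarrow> periodic P (per w)"
proof (cases "w = []")
  case False
  assume "length w dvd P \<or> w = []"
  with False obtain q where "P = length w * q" by (auto simp: dvd_def)
  then show ?thesis by (simp add: periodic_def per_def)
qed (simp add: periodic_def per_def)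

lemma concat_map_pairs:
  "concat (map g [0..<2 * l + 2]) =
    g 0 @ g 1 @ concat (map (\<lambda>i. g (2 * i + 2) @ g (2 * i + 3)) [0..<l])"
proof (induction l)
  case 0
  have "[0..<2] = [0, 1 :: nat]" by (simp add: upt_rec)
  then show ?case by simp
next
  case (Suc l)
  have "2 * Suc l + 2 = Suc (Suc (2 * l + 2))" by simp
  then have "[0..<2 * Suc l + 2] = [0..<2 * l + 2] @ [2 * l + 2, 2 * l + 3]"
    by (simp only: upt_Suc) simp
  then show ?case using Suc by (simp del: upt_Suc) simp
qed

text \<open>There are \<open>2 l + 3\<close> sides: \<open>l + 1\<close> constants, \<open>l\<close>
  powers and an empty side at each end. The diagram thus has
  \<open>2 (2 l + 3) - 3 = 4 l + 3\<close> pairs with one parameter each; \<open>l\<close> further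
  parameters are reserved for trivial bases, which makes \<open>5 l + 3\<close> columns. Dividing
  side lengths by the length of the base turns them into exponents and preserves the bounds from
  \<open>pumps\<close>.\<close>

lemma exp_word_small_linear:
  fixes ws ts :: "'a word list" and k :: "nat \<Rightarrow> int"
  defines "l \<equiv> length ts"
  assumes len: "length ws = Suc l" and N: "\<And>w. w \<in> set ws \<union> set ts \<Longrightarrow> length w \<le> N"
    and triv: "exp_word ws ts k \<approx> []"
  defines "P \<equiv> fact (3 * N + 1) :: nat"
  obtains z :: "nat \<Rightarrow> int" and M :: "nat \<Rightarrow> nat \<Rightarrow> int" where
    "\<And>i. i < l \<Longrightarrow> \<bar>z i\<bar> \<le> int (4 * P * (4 * l + 3))"
    "\<And>i j. i < l \<Longrightarrow> j < 5 * l + 3 \<Longrightarrow> \<bar>M i j\<bar> \<le> int (2 * P)"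
    "\<exists>v. \<forall>i<l. k i = z i + (\<Sum>j<5 * l + 3. M i j * int (v j))"
    "\<And>v. exp_word ws ts (\<lambda>i. z i + (\<Sum>j<5 * l + 3. M i j * int (v j))) \<approx> []"
proof -
  have P: "P > 0" "3 * N < P"
    using fact_ge_self[of "3 * N + 1"] by (simp_all add: P_def)
  have dvdP: "length w dvd P \<or> w = []" if "length w \<le> 3 * N" for w :: "'a word"
  proof (cases "w = []")
    case False
    then have "length w dvd fact (3 * N + 1)" using that by (intro dvd_fact) (auto simp: Suc_le_eq)
    then show ?thesis unfolding P_def ..
  qed simp
  \<comment> \<open>Only absolute values are pumped, so that all exponents are natural numbers; the
    signs stay those of the given solution.\<close>
  define sg where "sg i = (if k i \<ge> 0 then 1 else - 1 :: int)" for i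
  define t where "t i = (if k i \<ge> 0 then ts ! i else inv_word (ts ! i))" for i
  have pw: "pw (ts ! i) (sg i * int n) = npw (t i) n" for i n
    by (simp add: pw_def sg_def t_def)
  have "\<exists>u s. t i \<approx> u @ s @ inv_word u \<and> reduced s \<and> (s \<noteq> [] \<longrightarrow> hd s \<noteq> flip (last s)) \<and>
      length s \<le> length (t i) \<and> length u \<le> length (t i)" for i
    by (metis cyclic_reduction)
  then obtain u0 s where us: "\<And>i. t i \<approx> u0 i @ s i @ inv_word (u0 i)" "\<And>i. reduced (s i)"
    "\<And>i. s i \<noteq> [] \<longrightarrow> hd (s i) \<noteq> flip (last (s i))"
    "\<And>i. length (s i) \<le> length (t i)" "\<And>i. length (u0 i) \<le> length (t i)"
    by metis
  have "length (t i) \<le> N" if "i < l" for i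
    using that N[of "ts ! i"] by (simp add: t_def l_def)
  then have lens: "length (s i) \<le> N" "length (u0 i) \<le> N" if "i < l" for i
    using that us(4,5)[of i] by (meson le_trans)+
  \<comment> \<open>No power follows the last constant factor, so nothing is to be absorbed on its
    right.\<close>
  define u where "u i = (if i < l then u0 i else [])" for i
  define w' where "w' = (\<lambda>i. red (if i = 0 then ws ! 0 @ u 0 else inv_word (u (i - 1)) @ ws ! i @ u i))"
  have lenw: "length (w' i) \<le> 3 * N" if "i \<le> l" for i
  proof -
    have "length (ws ! i) \<le> N" using that len N[of "ws ! i"] by simp
    moreover have "length (u i) \<le> N" for i using lens(2)[of i] by (simp add: u_def)
    from this[of i] this[of "i - 1"] have "length (u i) \<le> N" "length (u (i - 1)) \<le> N" by auto
    ultimately have "length (if i = 0 then ws ! 0 @ u 0 else inv_word (u (i - 1)) @ ws ! i @ u i) \<le> 3 * N"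
      by auto
    then show ?thesis unfolding w'_def using length_red le_trans by blast
  qed
  have regroup: "exp_word ws ts (\<lambda>i. sg i * int (e i)) \<approx>
      w' 0 @ concat (map (\<lambda>i. npw (s i) (e i) @ w' (Suc i)) [0..<l])" for e
  proof -
    have "exp_word ws ts (\<lambda>i. sg i * int (e i)) \<approx>
        ws ! 0 @ concat (map (\<lambda>i. u i @ npw (s i) (e i) @ inv_word (u i) @ ws ! Suc i) [0..<l]) @ u l"
      unfolding exp_word_def pw l_def[symmetric]
    proof -
      have "npw (t i) (e i) @ ws ! Suc i \<approx> (u i @ npw (s i) (e i) @ inv_word (u i)) @ ws ! Suc i"
        if "i < l" for i
        using fequiv_append[OF fequiv_npw_conj[OF us(1)] fequiv_refl] that by (simp add: u_def)
      then have "concat (map (\<lambda>i. npw (t i) (e i) @ ws ! Suc i) [0..<l]) \<approx>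
          concat (map (\<lambda>i. u i @ npw (s i) (e i) @ inv_word (u i) @ ws ! Suc i) [0..<l])"
        by (intro fequiv_concat) auto
      from fequiv_append[OF fequiv_refl this, of "ws ! 0"]
      show "ws ! 0 @ concat (map (\<lambda>i. npw (t i) (e i) @ ws ! Suc i) [0..<l]) \<approx>
        ws ! 0 @ concat (map (\<lambda>i. u i @ npw (s i) (e i) @ inv_word (u i) @ ws ! Suc i) [0..<l]) @ u l"
        by (simp add: u_def[of l])
    qed
    then show ?thesis
      using fequiv_regroup[of "\<lambda>i. ws ! i" u "\<lambda>i. npw (s i) (e i)" l] unfolding w'_def
      by (rule free_cong.trans)
  qed
  define ns where "ns i = nat \<bar>k i\<bar> * length (s i)" for i
  \<comment> \<open>Position \<open>2 i + 1\<close> holds the constant \<open>w' i\<close>, position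
    \<open>2 i + 2\<close> the \<open>i\<close>-th power, and the two ends are empty.\<close>
  define side where "side ns j = (if j = 0 \<or> j = 2 * l + 2 then (per [], 0)
    else if odd j then (per (w' (j div 2)), length (w' (j div 2)))
    else (per (s (j div 2 - 1)), ns (j div 2 - 1)))" for ns :: "nat \<Rightarrow> nat" and j
  have concat_side: "concat (map (seg \<circ> side ns) [0..<2 * l + 3]) =
      w' 0 @ concat (map (\<lambda>i. seg (per (s i), ns i) @ w' (Suc i)) [0..<l])" for ns
  proof -
    have "2 * l + 3 = Suc (2 * l + 2)" by simp
    then have "[0..<2 * l + 3] = [0..<2 * l + 2] @ [2 * l + 2]" by (simp only: upt_Suc) simp
    moreover have "seg (side ns (2 * i + 2)) = seg (per (s i), ns i)"
      "seg (side ns (2 * i + 3)) = w' (Suc i)" if "i < l" for i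
      using that by (simp_all add: side_def seg_per_1)
    moreover have "seg (side ns 0) = []" "seg (side ns 1) = w' 0" "seg (side ns (2 * l + 2)) = []"
      by (auto simp: side_def seg_per_1)
    ultimately show ?thesis
      using concat_map_pairs[of "\<lambda>j. seg (side ns j)" l]
      by (auto simp: comp_def simp del: upt_Suc intro!: arg_cong[where f = concat])
  qed
  define ss where "ss = map (side ns) [0..<2 * l + 3]"
  have len_ss: "length ss = 2 * l + 3" by (simp add: ss_def)
  have ns_seg: "seg (per (s i), ns i) = npw (s i) (nat \<bar>k i\<bar>)" for i
    by (simp add: ns_def seg_per)
  have "diagram (2 * length ss - 3) ss"
  proof (rule diagram_of_trivial)
    show "2 \<le> length ss" by (simp add: len_ss)
    have "hd ss = side ns 0" unfolding ss_def by (simp add: hd_map upt_rec)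
    then show "snd (hd ss) = 0" by (simp add: side_def)
    have "2 * l + 3 = Suc (2 * l + 2)" by simp
    then have "last ss = side ns (2 * l + 2)" unfolding ss_def by (simp only: upt_Suc) simp
    then show "snd (last ss) = 0" by (simp add: side_def)
    have "reduced (seg (side ns j))" for j
      using reduced_npw[OF us(2,3)] by (simp add: side_def seg_per_1 ns_seg w'_def reduced_red)
    then show "list_all (\<lambda>\<sigma>. reduced (seg \<sigma>)) ss" by (simp add: ss_def list_all_iff)
    have "sg i * int (nat \<bar>k i\<bar>) = k i" for i by (simp add: sg_def)
    then show "concat (map seg ss) \<approx> []"
      using regroup[of "\<lambda>i. nat \<bar>k i\<bar>"] triv concat_side[of ns]
      by (auto simp: ss_def ns_seg intro: free_cong.trans free_cong.sym)
  qed
  moreover define p where "p = 4 * l + 3"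
  moreover have "2 * length ss - 3 = p" by (simp add: len_ss p_def)
  moreover have "\<forall>(f, n)\<in>set ss. periodic P f"
  proof -
    have "periodic P (fst (side ns j))" if "j < 2 * l + 3" for j
    proof (cases "j = 0 \<or> j = 2 * l + 2")
      case False
      show ?thesis
      proof (cases "odd j")
        case True
        then have "length (w' (j div 2)) \<le> 3 * N" using that False by (intro lenw) auto
        then show ?thesis using True False by (auto simp: side_def intro!: periodic_per dvdP)
      next
        case even: False
        then have "length (s (j div 2 - 1)) \<le> N" using that False by (intro lens) auto
        then show ?thesis using even False by (auto simp: side_def intro!: periodic_per dvdP)
      qed
    qed (auto simp: side_def intro: periodic_per)
    then show ?thesis unfolding ss_def by (simp add: split_beta)
  qed
  ultimately obtain R where R: "pumps P p ss R"
    using diagram_pumps[of p ss P] P(1) by auto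
  obtain v0 where v0: "ss = map (eval_side p v0) R" using R by (auto simp: pumps_def)
  have lenR: "length R = 2 * l + 3" using arg_cong[OF v0, of length] len_ss by simp
  define Z where "Z j = fst (snd (R ! j))" for j
  define r where "r j = snd (snd (R ! j))" for j
  have R_nth: "R ! j = (fst (side ns j), Z j, r j)" if "j < 2 * l + 3" for j
  proof -
    have "side ns j = eval_side p v0 (R ! j)"
      using arg_cong[OF v0, of "\<lambda>xs. xs ! j"] that lenR by (simp add: ss_def del: upt_Suc)
    then show ?thesis by (simp add: Z_def r_def eval_side_def prod_eq_iff split: prod.splits)
  qed
  have n_eq: "snd (side ns j) = Z j + (\<Sum>c<p. r j c * v0 c)" if "j < 2 * l + 3" for j
  proof -
    have "side ns j = eval_side p v0 (R ! j)"
      using arg_cong[OF v0, of "\<lambda>xs. xs ! j"] that lenR by (simp add: ss_def del: upt_Suc)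
    then have "side ns j = (fst (side ns j), Z j + (\<Sum>c<p. r j c * v0 c))"
      unfolding R_nth[OF that] by (simp only: eval_side_def prod.case)
    from arg_cong[OF this, of snd] show ?thesis by (simp only: snd_conv)
  qed
  have dvd: "P dvd r j c" if "j < 2 * l + 3" "c < p" for j c
  proof -
    have "R ! j \<in> set R" using that lenR by simp
    moreover have "\<forall>(f, z, r)\<in>set R. \<forall>j<p. P dvd r j" using R by (simp add: pumps_def)
    ultimately show ?thesis using that(2) R_nth[OF that(1)] by auto
  qed
  have small: "r j c = 0" if "j < 2 * l + 3" "c < p" "snd (side ns j) < P" for j c
  proof -
    have "list_all2 (\<lambda>(f, n) (g, z, r). n < P \<longrightarrow> (\<forall>j<p. r j = 0)) ss R"
      using R by (simp add: pumps_def)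
    from list_all2_nthD2[OF this, of j] show ?thesis
      using that lenR by (simp add: R_nth ss_def split_beta del: upt_Suc)
  qed
  have Zle: "Z j \<le> 4 * P * p" if "j < 2 * l + 3" for j
  proof -
    have "R ! j \<in> set R" using that lenR by simp
    then have "Z j \<in> set (map (\<lambda>(f, z, r). z) R)"
      by (auto simp: Z_def split_beta)
    then have "Z j \<le> (\<Sum>(f, z, r)\<leftarrow>R. z)" by (rule member_le_sum_list) simp
    then show ?thesis using R by (simp add: pumps_def)
  qed
  have rle: "r j c \<le> 2 * P" if "j < 2 * l + 3" "c < p" for j c
  proof -
    have "R ! j \<in> set R" using that lenR by simp
    then have "r j c \<in> set (map (\<lambda>(f, z, r). r c) R)"
      by (auto simp: r_def split_beta)
    then have "r j c \<le> (\<Sum>(f, z, r)\<leftarrow>R. r c)" by (rule member_le_sum_list) simp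
    then show ?thesis using R that by (fastforce simp: pumps_def)
  qed
  define L where "L i = length (s i)" for i
  define J where "J i = 2 * i + 2" for i :: nat
  have jl: "J i < 2 * l + 3" if "i < l" for i using that by (simp add: J_def)
  have side_even: "side ns (J i) = (per (s i), ns i)" if "i < l" for i ns
    using that by (simp add: side_def J_def)
  have L0: "Z (J i) = 0" "\<And>c. c < p \<Longrightarrow> r (J i) c = 0" if "i < l" "L i = 0" for i
    using that n_eq[OF jl, of i] small[OF jl, of i] P by (simp_all add: side_even ns_def L_def)
  have Ldvd: "L i dvd r (J i) c" if "i < l" "c < p" for i c
  proof (cases "L i = 0")
    case False
    have "L i dvd P" using dvdP[of "s i"] lens(1)[OF that(1)] False by (auto simp: L_def)
    then show ?thesis using dvd[OF jl that(2)] that by (meson dvd_trans)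
  qed (use L0 that in auto)
  \<comment> \<open>In the given solution the whole side length is a multiple of \<open>L i\<close>,
    and so is its pumped part; hence the constant part is one too.\<close>
  have LdvdZ: "L i dvd Z (J i)" if "i < l" for i
  proof -
    have "Z (J i) + (\<Sum>c<p. r (J i) c * v0 c) = nat \<bar>k i\<bar> * L i"
      using n_eq[OF jl[OF that]] by (simp add: side_even that ns_def L_def)
    then have "L i dvd Z (J i) + (\<Sum>c<p. r (J i) c * v0 c)" by simp
    moreover have "L i dvd (\<Sum>c<p. r (J i) c * v0 c)"
      using Ldvd[OF that] by (intro dvd_sum) auto
    ultimately show ?thesis by (simp add: dvd_add_left_iff)
  qed
  \<comment> \<open>If \<open>L i = 0\<close>, the base is trivial and its side has length 0
    whatever the exponent. The quotients are then 0, and the reserved parameter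
    \<open>v (p + i)\<close> supplies the exponent.\<close>
  define e where "e v i = Z (J i) div L i + (\<Sum>c<p. r (J i) c div L i * v c) +
    (if L i = 0 then v (p + i) else 0)" for v :: "nat \<Rightarrow> nat" and i
  have eL: "e v i * L i = Z (J i) + (\<Sum>c<p. r (J i) c * v c)" if "i < l" for v i
  proof (cases "L i = 0")
    case False
    have "r (J i) c div L i * v c * L i = r (J i) c * v c" if "c < p" for c
      using Ldvd[OF \<open>i < l\<close> that] by (metis dvd_div_mult_self mult.assoc mult.commute)
    then have "(\<Sum>c<p. r (J i) c div L i * v c) * L i = (\<Sum>c<p. r (J i) c * v c)"
      unfolding sum_distrib_right by (intro sum.cong) auto
    then show ?thesis
      using False LdvdZ[OF that] by (simp add: e_def distrib_right)
  qed (use L0[OF that] in simp)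
  define z where "z i = sg i * int (Z (J i) div L i)" for i
  define M where "M i c = sg i * (if c < p then int (r (J i) c div L i)
    else if L i = 0 \<and> c = p + i then 1 else 0)" for i c
  have zM: "z i + (\<Sum>j<5 * l + 3. M i j * int (v j)) = sg i * int (e v i)" if "i < l" for v i
  proof -
    have "{..<5 * l + 3} = {..<p} \<union> {p..<p + l}" by (auto simp: p_def)
    then have "(\<Sum>j<5 * l + 3. M i j * int (v j)) =
        (\<Sum>j<p. M i j * int (v j)) + (\<Sum>j\<in>{p..<p + l}. M i j * int (v j))"
      by (simp add: sum.union_disjoint ivl_disj_int)
    also have "(\<Sum>j\<in>{p..<p + l}. M i j * int (v j)) =
        (\<Sum>j\<in>{p..<p + l}. if j = p + i then (if L i = 0 then sg i * int (v (p + i)) else 0) else 0)"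
      by (intro sum.cong) (auto simp: M_def)
    also have "\<dots> = sg i * int (if L i = 0 then v (p + i) else 0)"
      using that by simp
    also have "(\<Sum>j<p. M i j * int (v j)) = sg i * int (\<Sum>c<p. r (J i) c div L i * v c)"
      by (simp add: M_def sum_distrib_left mult.assoc)
    finally show ?thesis by (simp add: z_def e_def distrib_left)
  qed
  have abs_sg: "\<bar>sg i * x\<bar> = \<bar>x\<bar>" for i x by (simp add: sg_def)
  show ?thesis
  proof (rule that[of z M])
    fix i assume i: "i < l"
    have "Z (J i) div L i \<le> 4 * P * p" using Zle[OF jl[OF i]] div_le_dividend le_trans by blast
    then have "int (Z (J i) div L i) \<le> int (4 * P * p)" by (simp only: of_nat_le_iff)
    then show "\<bar>z i\<bar> \<le> int (4 * P * (4 * l + 3))" by (simp add: z_def abs_sg p_def)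
    fix j
    show "\<bar>M i j\<bar> \<le> int (2 * P)"
    proof (cases "j < p")
      case True
      have "r (J i) j div L i \<le> 2 * P" using rle[OF jl[OF i] True] div_le_dividend le_trans by blast
      then have "int (r (J i) j div L i) \<le> int (2 * P)" by (simp only: of_nat_le_iff)
      then show ?thesis using True by (simp add: M_def abs_sg)
    next
      case False
      then show ?thesis using P(1) by (auto simp: M_def abs_sg)
    qed
  next
    \<comment> \<open>The parameters of the given solution: those of the diagram, followed by the
      exponents that trivial bases leave free.\<close>
    define v where "v c = (if c < p then v0 c else nat \<bar>k (c - p)\<bar>)" for c
    show "\<exists>v. \<forall>i<l. k i = z i + (\<Sum>j<5 * l + 3. M i j * int (v j))"
    proof (intro exI[of _ v] allI impI)
      fix i assume i: "i < l"
      have "e v i = nat \<bar>k i\<bar>"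
      proof (cases "L i = 0")
        case True
        then show ?thesis using L0[OF i True] by (simp add: e_def v_def)
      next
        case False
        have "e v i * L i = Z (J i) + (\<Sum>c<p. r (J i) c * v0 c)"
          unfolding eL[OF i] by (simp add: v_def)
        also have "\<dots> = nat \<bar>k i\<bar> * L i"
          using n_eq[OF jl[OF i]] by (simp add: side_even i ns_def L_def)
        finally show ?thesis using False by simp
      qed
      then show "k i = z i + (\<Sum>j<5 * l + 3. M i j * int (v j))"
        by (simp add: zM[OF i] sg_def)
    qed
  next
    fix v
    have "exp_word ws ts (\<lambda>i. z i + (\<Sum>j<5 * l + 3. M i j * int (v j))) =
        exp_word ws ts (\<lambda>i. sg i * int (e v i))"
    proof (rule exp_word_cong)
      fix i assume "i < length ts"
      then have "i < l" by (simp add: l_def)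
      then show "z i + (\<Sum>j<5 * l + 3. M i j * int (v j)) = sg i * int (e v i)" by (rule zM)
    qed
    moreover have "concat (map (seg \<circ> eval_side p v) R) =
        concat (map (seg \<circ> side (\<lambda>i. e v i * L i)) [0..<2 * l + 3])"
    proof -
      have "eval_side p v (R ! j) = side (\<lambda>i. e v i * L i) j" if j: "j < 2 * l + 3" for j
      proof (cases "even j \<and> j \<noteq> 0 \<and> j \<noteq> 2 * l + 2")
        case True
        define i where "i = j div 2 - 1"
        have i: "j = J i" using True unfolding i_def J_def by presburger
        have "i < l" using i j True by (auto simp: J_def)
        then show ?thesis using R_nth[OF j] by (simp add: i side_even eval_side_def eL)
      next
        case False
        \<comment> \<open>Constant factors and the empty ends are shorter than \<open>P\<close>, so
          pumping leaves them unchanged.\<close>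
        have lt: "snd (side ns j) < P"
        proof (cases "odd j")
          case True
          then have "j div 2 \<le> l" using j by presburger
          then have "length (w' (j div 2)) \<le> 3 * N" by (rule lenw)
          then show ?thesis using True P by (auto simp: side_def)
        qed (use False P in \<open>auto simp: side_def\<close>)
        have "side (\<lambda>i. e v i * L i) j = side ns j" using False by (auto simp: side_def)
        moreover have "snd (side ns j) = Z j" using n_eq[OF j] small[OF j _ lt] by simp
        moreover have "eval_side p v (R ! j) = (fst (side ns j), Z j)"
          using R_nth[OF j] small[OF j _ lt] by (simp add: eval_side_def)
        ultimately show ?thesis by (simp add: prod_eq_iff)
      qed
      then have "map (seg \<circ> eval_side p v) R = map (seg \<circ> side (\<lambda>i. e v i * L i)) [0..<2 * l + 3]"
        by (intro nth_equalityI) (auto simp: lenR simp del: upt_Suc)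
      then show ?thesis by simp
    qed
    moreover have "concat (map (seg \<circ> eval_side p v) R) \<approx> []" using R by (simp add: pumps_def)
    ultimately show "exp_word ws ts (\<lambda>i. z i + (\<Sum>j<5 * l + 3. M i j * int (v j))) \<approx> []"
      using regroup[of "e v"] concat_side[of "\<lambda>i. e v i * L i"]
      by (auto simp: L_def seg_per intro: free_cong.trans)
  qed
qed

section \<open>Computable functions\<close>

text \<open>Decomposing an expression in the argument list \<open>e\<close> by the closure rules in
  \<open>comp_intros\<close> yields the recursive function as the existential witness, so that none
  has to be written out.\<close>

definition computable :: "nat \<Rightarrow> (nat list \<Rightarrow> nat) \<Rightarrow> bool" where
  "computable n f \<longleftrightarrow> (\<exists>r. \<forall>e. length e = n \<longrightarrow> rec_eval r e (f e))"

lemma computable_app: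
  assumes "computable (length gs) F" "\<And>g. g \<in> set gs \<Longrightarrow> computable n g"
  shows "computable n (\<lambda>e. F (map (\<lambda>g. g e) gs))"
proof -
  obtain r where r: "\<And>e. length e = length gs \<Longrightarrow> rec_eval r e (F e)"
    using assms(1) by (auto simp: computable_def)
  have "\<exists>h. \<forall>g\<in>set gs. \<forall>e. length e = n \<longrightarrow> rec_eval (h g) e (g e)"
    using assms(2) unfolding computable_def by metis
  then obtain h where h: "\<And>g e. g \<in> set gs \<Longrightarrow> length e = n \<Longrightarrow> rec_eval (h g) e (g e)"
    by blast
  have "rec_eval (Comp r (map h gs)) e (F (map (\<lambda>g. g e) gs))" if "length e = n" for e
    using h that r by (intro rec_eval.Comp[where ys = "map (\<lambda>g. g e) gs"]) (auto simp: list_all2_conv_all_nth)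
  then show ?thesis unfolding computable_def by blast
qed

lemma computable_cong: "computable n g \<Longrightarrow> (\<And>e. length e = n \<Longrightarrow> f e = g e) \<Longrightarrow> computable n f"
  by (simp add: computable_def)

named_theorems comp_intros

lemma computable_nth [comp_intros]: "i < n \<Longrightarrow> computable n (\<lambda>e. e ! i)"
  unfolding computable_def by (metis rec_eval.Proj)

lemma computable_nth_drop [comp_intros]:
  assumes "k + i < n" shows "computable n (\<lambda>e. drop k e ! i)"
proof -
  have "rec_eval (Proj (k + i)) e (drop k e ! i)" if "length e = n" for e
    using rec_eval.Proj[of "k + i" e] assms that by simp
  then show ?thesis unfolding computable_def by blast
qed

lemma computable_comp1:
  assumes "computable 1 (\<lambda>e. F (e ! 0))" "computable n f"
  shows "computable n (\<lambda>e. F (f e))"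
  using computable_app[of "[f]" "\<lambda>e. F (e ! 0)" n] assms by simp

lemma computable_comp2:
  assumes "computable 2 (\<lambda>e. F (e ! 0) (e ! 1))" "computable n f" "computable n g"
  shows "computable n (\<lambda>e. F (f e) (g e))"
  using computable_app[of "[f, g]" "\<lambda>e. F (e ! 0) (e ! 1)" n] assms by (auto simp: numeral_eq_Suc)

lemma computable_comp3:
  assumes "computable 3 (\<lambda>e. F (e ! 0) (e ! 1) (e ! 2))" "computable n f" "computable n g"
    "computable n h"
  shows "computable n (\<lambda>e. F (f e) (g e) (h e))"
  using computable_app[of "[f, g, h]" "\<lambda>e. F (e ! 0) (e ! 1) (e ! 2)" n] assms
  by (auto simp: numeral_eq_Suc)

lemma computable_comp4:
  assumes "computable 4 (\<lambda>e. F (e ! 0) (e ! 1) (e ! 2) (e ! 3))" "computable n f" "computable n g"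
    "computable n h" "computable n k"
  shows "computable n (\<lambda>e. F (f e) (g e) (h e) (k e))"
  using computable_app[of "[f, g, h, k]" "\<lambda>e. F (e ! 0) (e ! 1) (e ! 2) (e ! 3)" n] assms
  by (auto simp: numeral_eq_Suc)

lemma computable_comp5:
  assumes "computable 5 (\<lambda>e. F (e ! 0) (e ! 1) (e ! 2) (e ! 3) (e ! 4))" "computable n f"
    "computable n g" "computable n h" "computable n k" "computable n l"
  shows "computable n (\<lambda>e. F (f e) (g e) (h e) (k e) (l e))"
  using computable_app[of "[f, g, h, k, l]" "\<lambda>e. F (e ! 0) (e ! 1) (e ! 2) (e ! 3) (e ! 4)" n] assms
  by (auto simp: numeral_eq_Suc)

lemma computable_Suc [comp_intros]:
  assumes "computable n f" shows "computable n (\<lambda>e. Suc (f e))"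
proof (rule computable_comp1[OF _ assms])
  have "rec_eval Succ e (Suc (e ! 0))" if "length e = 1" for e
    using that rec_eval.Succ[of "e ! 0"] by (cases e) auto
  then show "computable 1 (\<lambda>e. Suc (e ! 0))" unfolding computable_def by blast
qed

lemma computable_const [comp_intros]: "computable n (\<lambda>e. c)"
proof (induction c)
  case 0
  show ?case unfolding computable_def using rec_eval.Zero by blast
qed (rule computable_Suc)

text \<open>\<open>PrimRec\<close> passes the counter and the previous value in front of the
  parameters, hence \<open>drop 2 e\<close> in the body. To recurse up to \<open>m e\<close>, it is
  composed with \<open>m\<close> followed by the \<open>n\<close> projections.\<close>

lemma computable_rec [comp_intros]:
  assumes "computable n b" "computable (Suc (Suc n)) (\<lambda>e. s (e ! 0) (e ! 1) (drop 2 e))"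
    "computable n m"
  shows "computable n (\<lambda>e. rec_nat (b e) (\<lambda>i r. s i r e) (m e))"
proof -
  obtain rb where rb: "\<And>e. length e = n \<Longrightarrow> rec_eval rb e (b e)"
    using assms(1) by (auto simp: computable_def)
  obtain rs where rs: "\<And>e. length e = Suc (Suc n) \<Longrightarrow> rec_eval rs e (s (e ! 0) (e ! 1) (drop 2 e))"
    using assms(2) by (auto simp: computable_def)
  have "rec_eval (PrimRec rb rs) (i # e) (rec_nat (b e) (\<lambda>i r. s i r e) i)" if "length e = n" for i e
  proof (induction i)
    case 0
    show ?case using rb[OF that] by (simp add: rec_eval.PrimRec_0)
  next
    case (Suc i)
    show ?case
      using rec_eval.PrimRec_Suc[OF Suc] rs[of "i # rec_nat (b e) (\<lambda>i r. s i r e) i # e"] that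
      by (simp add: numeral_2_eq_2)
  qed
  then have "rec_eval (PrimRec rb rs) e (rec_nat (b (tl e)) (\<lambda>i r. s i r (tl e)) (hd e))"
    if "length e = Suc n" for e
    using that by (cases e) auto
  then have "computable (Suc n) (\<lambda>e. rec_nat (b (tl e)) (\<lambda>i r. s i r (tl e)) (hd e))"
    unfolding computable_def by blast
  then have rec: "computable (length (m # map (\<lambda>i e. e ! i) [0..<n]))
      (\<lambda>e. rec_nat (b (tl e)) (\<lambda>i r. s i r (tl e)) (hd e))"
    by simp
  have "computable n g" if "g \<in> set (m # map (\<lambda>i e. e ! i) [0..<n])" for g
    using that assms(3) by (auto intro: computable_nth)
  from computable_app[OF rec this]
  have "computable n (\<lambda>e. rec_nat (b (map (\<lambda>i. e ! i) [0..<n]))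
      (\<lambda>i r. s i r (map (\<lambda>i. e ! i) [0..<n])) (m e))"
    by (simp add: comp_def)
  then show ?thesis
  proof (rule computable_cong)
    fix e :: "nat list" assume "length e = n"
    then have "map (\<lambda>i. e ! i) [0..<n] = e" using map_nth[of e] by simp
    then show "rec_nat (b e) (\<lambda>i r. s i r e) (m e) = rec_nat (b (map (\<lambda>i. e ! i) [0..<n]))
        (\<lambda>i r. s i r (map (\<lambda>i. e ! i) [0..<n])) (m e)" by simp
  qed
qed

lemma computable_add [comp_intros]:
  assumes "computable n f" "computable n g" shows "computable n (\<lambda>e. f e + g e)"
proof (rule computable_comp2[OF _ assms])
  have eq: "a + b = rec_nat b (\<lambda>_ r. Suc r) a" for a b :: nat by (induction a) auto
  show "computable 2 (\<lambda>e. e ! 0 + e ! 1)"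
    by (rule computable_cong[OF _ eq]) (intro comp_intros; simp)
qed

lemma computable_mult [comp_intros]:
  assumes "computable n f" "computable n g" shows "computable n (\<lambda>e. f e * g e)"
proof (rule computable_comp2[OF _ assms])
  have eq: "a * b = rec_nat 0 (\<lambda>_ r. r + b) a" for a b :: nat by (induction a) auto
  show "computable 2 (\<lambda>e. e ! 0 * e ! 1)"
    by (rule computable_cong[OF _ eq]) (intro comp_intros; simp)
qed

lemma computable_diff [comp_intros]:
  assumes "computable n f" "computable n g" shows "computable n (\<lambda>e. f e - g e)"
proof (rule computable_comp2[OF _ assms])
  have pred: "computable n (\<lambda>e. f e - 1)" if "computable n f" for n f
  proof (rule computable_comp1[OF _ that])
    have eq: "a - 1 = rec_nat 0 (\<lambda>i _. i) a" for a :: nat by (induction a) auto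
    show "computable 1 (\<lambda>e. e ! 0 - 1)"
      by (rule computable_cong[OF _ eq]) (intro comp_intros; simp)
  qed
  have eq: "a - b = rec_nat a (\<lambda>_ r. r - 1) b" for a b :: nat by (induction b) auto
  have "computable 2 (\<lambda>e. rec_nat (e ! 0) (\<lambda>_ r. r - 1) (e ! 1))"
    by (intro comp_intros pred; simp)
  then show "computable 2 (\<lambda>e. e ! 0 - e ! 1)"
    by (rule computable_cong) (rule eq)
qed

lemma computable_sum [comp_intros]:
  assumes "computable (Suc (Suc n)) (\<lambda>e. f (e ! 0) (drop 2 e))" "computable n m"
  shows "computable n (\<lambda>e. \<Sum>i<m e. f i e)"
proof -
  have eq: "(\<Sum>i<m. f i e) = rec_nat 0 (\<lambda>i r. r + f i e) m" for m e by (induction m) auto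
  show ?thesis
    by (rule computable_cong[OF _ eq]) (intro comp_intros assms; simp)
qed

lemma computable_not [comp_intros]:
  assumes "computable n (\<lambda>e. of_bool (P e))"
  shows "computable n (\<lambda>e. of_bool (\<not> P e))"
proof -
  have eq: "of_bool (\<not> P e) = 1 - (of_bool (P e) :: nat)" for e by simp
  show ?thesis by (rule computable_cong[OF _ eq]) (intro comp_intros assms)
qed

lemma computable_conj [comp_intros]:
  assumes "computable n (\<lambda>e. of_bool (P e))" "computable n (\<lambda>e. of_bool (Q e))"
  shows "computable n (\<lambda>e. of_bool (P e \<and> Q e))"
  using assms unfolding of_bool_conj by (intro comp_intros)

lemma computable_imp [comp_intros]:
  assumes "computable n (\<lambda>e. of_bool (P e))" "computable n (\<lambda>e. of_bool (Q e))"
  shows "computable n (\<lambda>e. of_bool (P e \<longrightarrow> Q e))"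
proof -
  have eq: "of_bool (P e \<longrightarrow> Q e) = (of_bool (\<not> (P e \<and> \<not> Q e)) :: nat)" for e by simp
  show ?thesis by (rule computable_cong[OF _ eq]) (intro comp_intros assms)
qed

lemma computable_eq [comp_intros]:
  assumes "computable n f" "computable n g"
  shows "computable n (\<lambda>e. of_bool (f e = g e))"
proof -
  have eq: "of_bool (f e = g e) = 1 - ((f e - g e) + (g e - f e))" for e by simp
  show ?thesis by (rule computable_cong[OF _ eq]) (intro comp_intros assms)
qed

lemma computable_all [comp_intros]:
  assumes "computable (Suc (Suc n)) (\<lambda>e. of_bool (P (e ! 0) (drop 2 e)))" "computable n m"
  shows "computable n (\<lambda>e. of_bool (\<forall>i<m e. P i e))"
proof -
  have eq: "of_bool (\<forall>i<m e. P i e) = (of_bool ((\<Sum>i<m e. of_bool (\<not> P i e)) = (0 :: nat)) :: nat)" for e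
    by auto
  show ?thesis by (rule computable_cong[OF _ eq]) (intro comp_intros assms; simp)
qed

lemma computable_if [comp_intros]:
  assumes "computable n (\<lambda>e. of_bool (P e))" "computable n f" "computable n g"
  shows "computable n (\<lambda>e. if P e then f e else g e)"
proof -
  have eq: "(if P e then f e else g e) = of_bool (P e) * f e + of_bool (\<not> P e) * g e" for e by simp
  show ?thesis by (rule computable_cong[OF _ eq]) (intro comp_intros assms)
qed

section \<open>Computing with codes\<close>

lemma computable_prod_encode [comp_intros]:
  assumes "computable n f" "computable n g"
  shows "computable n (\<lambda>e. prod_encode (f e, g e))"
proof (rule computable_comp2[OF _ assms])
  have "triangle k = (\<Sum>i<Suc k. i)" for k by (induction k) auto
  then have eq: "prod_encode (a, b) = (\<Sum>i<Suc (a + b). i) + a" for a b by (simp add: prod_encode_def)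
  show "computable 2 (\<lambda>e. prod_encode (e ! 0, e ! 1))"
    by (rule computable_cong[OF _ eq]) (intro comp_intros; simp)
qed

definition pfst :: "nat \<Rightarrow> nat" where "pfst c = fst (prod_decode c)"
definition psnd :: "nat \<Rightarrow> nat" where "psnd c = snd (prod_decode c)"

lemma pfst_encode [simp]: "pfst (prod_encode (a, b)) = a"
  and psnd_encode [simp]: "psnd (prod_encode (a, b)) = b"
  and prod_encode_pfst_psnd [simp]: "prod_encode (pfst c, psnd c) = c"
  by (simp_all add: pfst_def psnd_def)

lemma pfst_le: "pfst c \<le> c" and psnd_le: "psnd c \<le> c"
  by (metis prod_encode_pfst_psnd le_prod_encode_1) (metis prod_encode_pfst_psnd le_prod_encode_2)

lemma prod_encode_eq_iff: "prod_encode (a, b) = c \<longleftrightarrow> a = pfst c \<and> b = psnd c"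
  by (metis pfst_encode psnd_encode prod_encode_pfst_psnd)

lemma sum_of_bool_select: "a < n \<Longrightarrow> (\<Sum>i<n. of_bool (i = a) * f i) = (f a :: nat)" for n :: nat
  by (subst sum.mono_neutral_cong_right[of _ "{a}" _ f]) auto

text \<open>Decoding is a bounded search: components do not exceed the code, so the result is the
  sum of all \<open>a \<le> c\<close>, each weighted by the number \<open>t a c\<close> of partners
  \<open>b\<close> that complete it to \<open>c\<close>. This weight is 0 or 1.\<close>

lemma computable_pfst [comp_intros]:
  assumes "computable n f" shows "computable n (\<lambda>e. pfst (f e))"
proof (rule computable_comp1[OF _ assms])
  define t :: "nat \<Rightarrow> nat \<Rightarrow> nat" where
    "t a c = (\<Sum>b<Suc c. of_bool (prod_encode (a, b) = c))" for a c
  have "computable 2 (\<lambda>e. t (e ! 0) (e ! 1))"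
    unfolding t_def by (intro comp_intros; simp)
  note [comp_intros] = computable_comp2[OF this]
  have t: "t a c = of_bool (a = pfst c)" for a c
  proof -
    have "t a c = (\<Sum>b<Suc c. of_bool (b = psnd c) * of_bool (a = pfst c))"
      unfolding t_def prod_encode_eq_iff by (rule sum.cong) auto
    also have "\<dots> = of_bool (a = pfst c)"
      by (rule sum_of_bool_select) (simp add: less_Suc_eq_le psnd_le)
    finally show ?thesis .
  qed
  have eq: "pfst c = (\<Sum>a<Suc c. t a c * a)" for c
    unfolding t by (rule sum_of_bool_select[symmetric]) (simp add: less_Suc_eq_le pfst_le)
  show "computable 1 (\<lambda>e. pfst (e ! 0))"
    by (rule computable_cong[OF _ eq]) (intro comp_intros; simp)
qed

lemma computable_psnd [comp_intros]:
  assumes "computable n f" shows "computable n (\<lambda>e. psnd (f e))"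
proof (rule computable_comp1[OF _ assms])
  have eq: "psnd c = (\<Sum>b<Suc c. of_bool (prod_encode (pfst c, b) = c) * b)" for c
    unfolding prod_encode_eq_iff simp_thms
    by (rule sum_of_bool_select[symmetric]) (simp add: less_Suc_eq_le psnd_le)
  show "computable 1 (\<lambda>e. psnd (e ! 0))"
    by (rule computable_cong[OF _ eq]) (intro comp_intros; simp)
qed

text \<open>The code of \<open>x # xs\<close> is
  \<open>Suc (prod_encode (x, list_encode xs))\<close>, so subtracting 1 opens it; the code 0 of the
  empty list is its own tail.\<close>

definition lhd :: "nat \<Rightarrow> nat" where "lhd c = pfst (c - 1)"
definition ltl :: "nat \<Rightarrow> nat" where "ltl c = psnd (c - 1)"
definition ldrop :: "nat \<Rightarrow> nat \<Rightarrow> nat" where "ldrop c i = rec_nat c (\<lambda>_ r. ltl r) i"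
definition lnth :: "nat \<Rightarrow> nat \<Rightarrow> nat" where "lnth c i = lhd (ldrop c i)"
text \<open>Counts the nonempty suffixes; searching below \<open>c\<close> is enough, as a list is
  never longer than its code.\<close>

definition llen :: "nat \<Rightarrow> nat" where "llen c = (\<Sum>i<c. of_bool (ldrop c i \<noteq> 0))"

lemma computable_lhd [comp_intros]: "computable n f \<Longrightarrow> computable n (\<lambda>e. lhd (f e))"
  and computable_ltl [comp_intros]: "computable n f \<Longrightarrow> computable n (\<lambda>e. ltl (f e))"
  unfolding lhd_def ltl_def by (intro comp_intros; assumption)+

lemma computable_ldrop [comp_intros]:
  "computable n f \<Longrightarrow> computable n g \<Longrightarrow> computable n (\<lambda>e. ldrop (f e) (g e))"
  by (rule computable_comp2[where F = ldrop];
    (assumption | unfold ldrop_def, intro comp_intros; simp))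

lemma computable_lnth [comp_intros]:
  "computable n f \<Longrightarrow> computable n g \<Longrightarrow> computable n (\<lambda>e. lnth (f e) (g e))"
  unfolding lnth_def by (intro comp_intros)

lemma computable_llen [comp_intros]: "computable n f \<Longrightarrow> computable n (\<lambda>e. llen (f e))"
  by (rule computable_comp1[where F = llen];
    (assumption | unfold llen_def, intro comp_intros; simp))

lemma ltl_list_encode: "ltl (list_encode xs) = list_encode (tl xs)"
proof (cases xs)
  case Nil
  have "psnd 0 = 0" using psnd_le[of 0] by simp
  then show ?thesis by (simp add: Nil ltl_def)
qed (simp add: ltl_def)

lemma ldrop_list_encode: "ldrop (list_encode xs) i = list_encode (drop i xs)"
  by (induction i) (simp_all add: ldrop_def ltl_list_encode drop_Suc tl_drop)

lemma lnth_list_encode: "i < length xs \<Longrightarrow> lnth (list_encode xs) i = xs ! i"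
  by (simp add: lnth_def ldrop_list_encode lhd_def flip: Cons_nth_drop_Suc)

lemma length_le_list_encode: "length xs \<le> list_encode xs"
proof (induction xs)
  case (Cons x xs)
  then show ?case using le_prod_encode_2[of "list_encode xs" x] by simp
qed simp

lemma list_encode_eq_0 [simp]: "list_encode xs = 0 \<longleftrightarrow> xs = []"
  by (cases xs) auto

lemma llen_list_encode [simp]: "llen (list_encode xs) = length xs"
proof -
  have "llen (list_encode xs) = (\<Sum>i<list_encode xs. of_bool (i < length xs))"
    by (simp only: llen_def ldrop_list_encode list_encode_eq_0 drop_eq_Nil not_le)
  also have "\<dots> = (\<Sum>i<length xs. 1)"
    using length_le_list_encode[of xs] by (intro sum.mono_neutral_cong_right) auto
  finally show ?thesis by simp
qed

text \<open>\<open>int_decode\<close> sends \<open>2 m\<close> to \<open>m\<close> and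
  \<open>2 m + 1\<close> to \<open>- (m + 1)\<close>. The halving is again done by bounded search,
  separately for the positive and the negative part.\<close>

definition ipos :: "nat \<Rightarrow> nat" where "ipos n = (\<Sum>i<Suc n. of_bool (i + i = n) * i)"
definition ineg :: "nat \<Rightarrow> nat" where "ineg n = (\<Sum>i<Suc n. of_bool (Suc (i + i) = n) * Suc i)"

lemma computable_ipos [comp_intros]: "computable n f \<Longrightarrow> computable n (\<lambda>e. ipos (f e))"
  by (rule computable_comp1[where F = ipos];
    (assumption | unfold ipos_def, intro comp_intros; simp))

lemma computable_ineg [comp_intros]: "computable n f \<Longrightarrow> computable n (\<lambda>e. ineg (f e))"
  by (rule computable_comp1[where F = ineg];
    (assumption | unfold ineg_def, intro comp_intros; simp))

lemma ipos_ineg: "int (ipos n) - int (ineg n) = int_decode n"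
proof (cases "even n")
  case True
  then obtain m where m: "n = 2 * m" by blast
  have "ipos n = (\<Sum>i<Suc n. of_bool (i = m) * i)" by (simp only: ipos_def m) (rule sum.cong; auto)
  moreover have "ineg n = 0" unfolding ineg_def m
    by (intro sum.neutral ballI) (metis double_not_eq_Suc_double mult.commute mult_2_right mult_zero_left of_bool_eq(1))
  ultimately show ?thesis
    using sum_of_bool_select[of m "Suc n" "\<lambda>i. i"] by (simp add: m int_decode_def sum_decode_def)
next
  case False
  then obtain m where m: "n = 2 * m + 1" by (elim oddE)
  have "ineg n = (\<Sum>i<Suc n. of_bool (i = m) * Suc i)" by (simp only: ineg_def m) (rule sum.cong; auto)
  moreover have "ipos n = 0" unfolding ipos_def m
    by (intro sum.neutral ballI) (auto, presburger)
  ultimately show ?thesis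
    using sum_of_bool_select[of m "Suc n" Suc] by (simp add: m int_decode_def sum_decode_def)
qed

text \<open>The code of the list of \<open>n\<close> copies of \<open>n\<close>. As
  \<open>prod_encode\<close> is monotone, it dominates the codes of all lists of length at most
  \<open>n\<close> with entries at most \<open>n\<close>.\<close>

definition code_bound :: "nat \<Rightarrow> nat" where
  "code_bound n = rec_nat 0 (\<lambda>_ r. Suc (prod_encode (n, r))) n"

lemma computable_code_bound [comp_intros]:
  "computable n f \<Longrightarrow> computable n (\<lambda>e. code_bound (f e))"
  by (rule computable_comp1[where F = code_bound];
    (assumption | unfold code_bound_def, intro comp_intros; simp))

lemma computable_fact [comp_intros]:
  assumes "computable n f" shows "computable n (\<lambda>e. fact (f e))"
proof (rule computable_comp1[OF _ assms])
  have eq: "fact k = rec_nat 1 (\<lambda>i r. Suc i * r) k" for k :: nat by (induction k) auto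
  show "computable 1 (\<lambda>e. fact (e ! 0))" by (rule computable_cong[OF _ eq]) (intro comp_intros; simp)
qed

lemma computable_power [comp_intros]:
  assumes "computable n f" "computable n g" shows "computable n (\<lambda>e. f e ^ g e)"
proof (rule computable_comp2[OF _ assms])
  have eq: "a ^ k = rec_nat 1 (\<lambda>_ r. a * r) k" for a k :: nat by (induction k) auto
  show "computable 2 (\<lambda>e. e ! 0 ^ e ! 1)" by (rule computable_cong[OF _ eq]) (intro comp_intros; simp)
qed

lemma prod_encode_mono: "a \<le> a' \<Longrightarrow> b \<le> b' \<Longrightarrow> prod_encode (a, b) \<le> prod_encode (a', b')"
proof -
  have "triangle m \<le> triangle n" if "m \<le> n" for m n
    using that by (rule lift_Suc_mono_le[of triangle, rotated]) simp
  then show "a \<le> a' \<Longrightarrow> b \<le> b' \<Longrightarrow> prod_encode (a, b) \<le> prod_encode (a', b')"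
    by (auto simp: prod_encode_def intro!: add_mono)
qed

lemma list_encode_le_code_bound:
  assumes "length xs \<le> n" "\<And>x. x \<in> set xs \<Longrightarrow> x \<le> n"
  shows "list_encode xs \<le> code_bound n"
proof -
  have "length ys \<le> m \<Longrightarrow> (\<forall>x\<in>set ys. x \<le> n) \<Longrightarrow>
      list_encode ys \<le> rec_nat 0 (\<lambda>_ r. Suc (prod_encode (n, r))) m" for ys m
  proof (induction ys arbitrary: m)
    case (Cons y ys)
    then obtain m' where "m = Suc m'" by (cases m) auto
    then show ?case using Cons by (simp add: prod_encode_mono)
  qed simp
  then show ?thesis using assms by (simp add: code_bound_def)
qed

lemma le_code_bound: "n \<le> code_bound n"
  using list_encode_le_code_bound[of "[n]" n] le_prod_encode_1[of n 0] by (cases n) auto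

section \<open>Computing reductions of words\<close>

definition cflip :: "nat \<Rightarrow> nat" where
  "cflip a = prod_encode (pfst a, 1 - psnd a)"

definition cpush :: "nat \<Rightarrow> nat \<Rightarrow> nat" where
  "cpush s a = (if s \<noteq> 0 \<and> lhd s = cflip a then ltl s else Suc (prod_encode (a, s)))"

definition cpush_word :: "nat \<Rightarrow> nat \<Rightarrow> nat" where
  "cpush_word s u = rec_nat s (\<lambda>j r. cpush r (lnth u j)) (llen u)"

definition cpush_inv_word :: "nat \<Rightarrow> nat \<Rightarrow> nat" where
  "cpush_inv_word s u = rec_nat s (\<lambda>j r. cpush r (cflip (lnth u (llen u - Suc j)))) (llen u)"

definition cpush_power :: "nat \<Rightarrow> nat \<Rightarrow> nat \<Rightarrow> nat" where
  "cpush_power s u n = rec_nat s (\<lambda>_ r. cpush_word r u) n"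

definition cpush_inv_power :: "nat \<Rightarrow> nat \<Rightarrow> nat \<Rightarrow> nat" where
  "cpush_inv_power s u n = rec_nat s (\<lambda>_ r. cpush_inv_word r u) n"

lemma computable_cpush [comp_intros]:
  "computable n f \<Longrightarrow> computable n g \<Longrightarrow> computable n (\<lambda>e. cpush (f e) (g e))"
  by (rule computable_comp2[where F = cpush];
    (assumption | unfold cpush_def cflip_def, intro comp_intros; simp))

lemma computable_cpush_word [comp_intros]:
  "computable n f \<Longrightarrow> computable n g \<Longrightarrow> computable n (\<lambda>e. cpush_word (f e) (g e))"
  by (rule computable_comp2[where F = cpush_word];
    (assumption | unfold cpush_word_def, intro comp_intros; simp))

lemma computable_cpush_inv_word [comp_intros]:
  "computable n f \<Longrightarrow> computable n g \<Longrightarrow> computable n (\<lambda>e. cpush_inv_word (f e) (g e))"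
  by (rule computable_comp2[where F = cpush_inv_word];
    (assumption | unfold cpush_inv_word_def cflip_def, intro comp_intros; simp))

lemma computable_cpush_power [comp_intros]:
  "computable n f \<Longrightarrow> computable n g \<Longrightarrow> computable n h \<Longrightarrow>
    computable n (\<lambda>e. cpush_power (f e) (g e) (h e))"
  by (rule computable_comp3[where F = cpush_power];
    (assumption | unfold cpush_power_def, intro comp_intros; simp))

lemma computable_cpush_inv_power [comp_intros]:
  "computable n f \<Longrightarrow> computable n g \<Longrightarrow> computable n h \<Longrightarrow>
    computable n (\<lambda>e. cpush_inv_power (f e) (g e) (h e))"
  by (rule computable_comp3[where F = cpush_inv_power];
    (assumption | unfold cpush_inv_power_def, intro comp_intros; simp))

abbreviation letter_code :: "nat \<times> bool \<Rightarrow> nat" where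
  "letter_code \<equiv> \<lambda>(i, b). prod_encode (i, of_bool b)"

lemma letter_code_eq_iff: "letter_code a = letter_code b \<longleftrightarrow> a = b"
  by (cases a; cases b) (simp add: of_bool_eq_iff)

lemma cflip_letter_code: "cflip (letter_code a) = letter_code (flip a)"
  by (cases a) (simp add: cflip_def flip_def)

lemma cpush_word_code: "cpush (word_code s) (letter_code a) = word_code (push s a)"
proof (cases s)
  case (Cons b s')
  have "lhd (word_code s) = letter_code b" "ltl (word_code s) = word_code s'" "word_code s \<noteq> 0"
    by (simp_all add: Cons word_code_def lhd_def ltl_def)
  then have "cpush (word_code s) (letter_code a) =
      (if b = flip a then word_code s' else Suc (prod_encode (letter_code a, word_code s)))"
    by (simp only: cpush_def cflip_letter_code letter_code_eq_iff) simp
  then show ?thesis by (simp add: Cons word_code_def)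
qed (simp add: cpush_def word_code_def)

lemma llen_word_code [simp]: "llen (word_code u) = length u"
  by (simp add: word_code_def)

lemma lnth_word_code: "j < length u \<Longrightarrow> lnth (word_code u) j = letter_code (u ! j)"
  by (simp add: word_code_def lnth_list_encode)

lemma rec_nat_cpush:
  assumes "\<And>j. j < length u \<Longrightarrow> a j = letter_code (u ! j)"
  shows "rec_nat (word_code s) (\<lambda>j r. cpush r (a j)) (length u) = word_code (foldl push s u)"
proof -
  have "n \<le> length u \<Longrightarrow>
    rec_nat (word_code s) (\<lambda>j r. cpush r (a j)) n = word_code (foldl push s (take n u))" for n
    by (induction n) (simp_all add: assms cpush_word_code take_Suc_conv_app_nth del: split_paired_All)
  from this[of "length u"] show ?thesis by simp
qed

lemma cpush_word: "cpush_word (word_code s) (word_code u) = word_code (foldl push s u)"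
  unfolding cpush_word_def llen_word_code by (rule rec_nat_cpush) (rule lnth_word_code)

lemma cpush_inv_word:
  "cpush_inv_word (word_code s) (word_code u) = word_code (foldl push s (inv_word u))"
proof -
  have "cflip (lnth (word_code u) (length u - Suc j)) = letter_code (inv_word u ! j)"
    if "j < length u" for j
  proof -
    have "cflip (lnth (word_code u) (length u - Suc j)) = cflip (letter_code (u ! (length u - Suc j)))"
      using that by (simp add: lnth_word_code)
    also have "\<dots> = letter_code (inv_word u ! j)"
      using that unfolding cflip_letter_code by (simp add: inv_word_eq rev_nth)
    finally show ?thesis .
  qed
  then show ?thesis
    using rec_nat_cpush[of "inv_word u" "\<lambda>j. cflip (lnth (word_code u) (length u - Suc j))" s]
    by (simp add: cpush_inv_word_def)
qed

lemma cpush_power: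
  "cpush_power (word_code s) (word_code u) n = word_code (foldl push s (npw u n))"
  by (induction n) (simp_all add: cpush_power_def cpush_word npw_Suc2)

lemma cpush_inv_power:
  "cpush_inv_power (word_code s) (word_code u) n = word_code (foldl push s (npw (inv_word u) n))"
  by (induction n) (simp_all add: cpush_inv_power_def cpush_inv_word npw_Suc2)

section \<open>The algorithm\<close>

text \<open>An exponent is computed as a difference of two natural numbers, each of which is pushed as a
  power of its own, so that no integer arithmetic is needed.\<close>

definition cpos :: "nat \<Rightarrow> nat \<Rightarrow> nat \<Rightarrow> nat \<Rightarrow> nat" where
  "cpos z q v i = ipos (lnth z i) + (\<Sum>j<llen q. ipos (lnth (lnth q j) i) * lnth v j)"

definition cneg :: "nat \<Rightarrow> nat \<Rightarrow> nat \<Rightarrow> nat \<Rightarrow> nat" where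
  "cneg z q v i = ineg (lnth z i) + (\<Sum>j<llen q. ineg (lnth (lnth q j) i) * lnth v j)"

text \<open>The exponent product is fed letter by letter to the stack of \<open>push\<close>, so
  only reversed reduced words are coded on the way. The result 0 is the empty stack, that is, a
  trivial product.\<close>

definition creduce :: "nat \<Rightarrow> nat \<Rightarrow> nat \<Rightarrow> nat \<Rightarrow> nat \<Rightarrow> nat" where
  "creduce x y z q v = rec_nat (cpush_word 0 (lnth x 0))
    (\<lambda>i r. cpush_word
      (cpush_inv_power (cpush_power r (lnth y i) (cpos z q v i)) (lnth y i) (cneg z q v i))
      (lnth x (Suc i))) (llen y)"

text \<open>One number for all purposes. With \<open>P = fact (3 * N + 1)\<close>, the codes of
  entries are at most \<open>8 P (4 N + 3) + 1\<close>, because \<open>int_encode a\<close> is at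
  most \<open>2 |a| + 1\<close>; there are at most \<open>5 N + 3\<close> columns; and
  \<open>2 ^ N\<close> covers the test parameters.\<close>

definition size_bound :: "nat \<Rightarrow> nat" where
  "size_bound N = 8 * fact (3 * N + 1) * (4 * N + 3) + 5 * N + 4 + 2 ^ N"

text \<open>The inner \<open>code_bound\<close> covers single vectors, the outer one lists of
  columns.\<close>

definition search_bound :: "nat \<Rightarrow> nat" where
  "search_bound N = (let B = code_bound (code_bound (size_bound N))
    in prod_encode (B, prod_encode (B, B)))"

text \<open>The length conditions single out codes of well-formed pairs. If the number of columns is
  within \<open>search_bound\<close>, the lists \<open>v\<close> include all parameters up to
  \<open>2 ^ length ts\<close>, as soundness demands.\<close>

definition ctest :: "nat \<Rightarrow> nat \<Rightarrow> nat \<Rightarrow> nat \<Rightarrow> nat \<Rightarrow> bool" where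
  "ctest x y z r q \<longleftrightarrow> llen z = llen y \<and> r = llen y \<and> (\<forall>j<llen q. llen (lnth q j) = llen y) \<and>
    (\<forall>v<Suc (code_bound (search_bound (x + y))). llen v = llen q \<longrightarrow> creduce x y z q v = 0)"

text \<open>The code of a list of words is at least its length and the length of each word in it, so
  \<open>x + y\<close> can serve as the bound \<open>N\<close>.\<close>

definition calg :: "nat \<Rightarrow> nat \<Rightarrow> nat" where
  "calg x y = rec_nat 0
    (\<lambda>c a. if ctest x y (pfst c) (pfst (psnd c)) (psnd (psnd c)) then Suc (prod_encode (c, a)) else a)
    (Suc (search_bound (x + y)))"

lemma computable_cpos [comp_intros]:
  "\<lbrakk>computable n f; computable n g; computable n h; computable n k\<rbrakk> \<Longrightarrow>
    computable n (\<lambda>e. cpos (f e) (g e) (h e) (k e))"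
  by (rule computable_comp4[where F = cpos];
    (assumption | unfold cpos_def, intro comp_intros; simp))

lemma computable_cneg [comp_intros]:
  "\<lbrakk>computable n f; computable n g; computable n h; computable n k\<rbrakk> \<Longrightarrow>
    computable n (\<lambda>e. cneg (f e) (g e) (h e) (k e))"
  by (rule computable_comp4[where F = cneg];
    (assumption | unfold cneg_def, intro comp_intros; simp))

lemma computable_creduce [comp_intros]:
  "\<lbrakk>computable n f; computable n g; computable n h; computable n k; computable n l\<rbrakk> \<Longrightarrow>
    computable n (\<lambda>e. creduce (f e) (g e) (h e) (k e) (l e))"
  by (rule computable_comp5[where F = creduce];
    (assumption | unfold creduce_def, intro comp_intros; simp))

lemma computable_search_bound [comp_intros]:
  "computable n f \<Longrightarrow> computable n (\<lambda>e. search_bound (f e))"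
  by (rule computable_comp1[where F = search_bound];
    (assumption | unfold search_bound_def size_bound_def Let_def, intro comp_intros; simp))

lemma computable_ctest [comp_intros]:
  "\<lbrakk>computable n f; computable n g; computable n h; computable n k; computable n l\<rbrakk> \<Longrightarrow>
    computable n (\<lambda>e. of_bool (ctest (f e) (g e) (h e) (k e) (l e)))"
  by (rule computable_comp5[where F = "\<lambda>a b c d e. of_bool (ctest a b c d e)"];
    (assumption | unfold ctest_def, intro comp_intros; simp))

lemma computable_calg: "computable 2 (\<lambda>e. calg (e ! 0) (e ! 1))"
  unfolding calg_def by (intro comp_intros; simp)

lemma calg_eq:
  "calg x y = list_encode (rev (filter
     (\<lambda>c. ctest x y (pfst c) (pfst (psnd c)) (psnd (psnd c))) [0..<Suc (search_bound (x + y))]))"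
proof -
  have "rec_nat 0 (\<lambda>c a. if P c then Suc (prod_encode (c, a)) else a) n =
      list_encode (rev (filter P [0..<n]))" for P n
    by (induction n) auto
  then show ?thesis unfolding calg_def .
qed

section \<open>Correctness of the test and completeness of the search\<close>

definition lin_point :: "nat list \<Rightarrow> nat list list \<Rightarrow> (nat \<Rightarrow> nat) \<Rightarrow> nat \<Rightarrow> int" where
  "lin_point zs cs v i =
     int_decode (zs ! i) + (\<Sum>j<length cs. int_decode (cs ! j ! i) * int (v j))"

lemma creduce_eq_0_iff:
  assumes len: "length ws = Suc (length ts)" "length zs = length ts"
    "\<forall>c\<in>set cs. length c = length ts" "length vs = length cs"
  shows "creduce (words_code ws) (words_code ts) (list_encode zs) (list_encode (map list_encode cs))
      (list_encode vs) = 0 \<longleftrightarrow> exp_word ws ts (lin_point zs cs (\<lambda>j. vs ! j)) \<approx> []"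
proof -
  define p where "p i = ipos (zs ! i) + (\<Sum>j<length cs. ipos (cs ! j ! i) * vs ! j)" for i
  define q where "q i = ineg (zs ! i) + (\<Sum>j<length cs. ineg (cs ! j ! i) * vs ! j)" for i
  have cpos: "cpos (list_encode zs) (list_encode (map list_encode cs)) (list_encode vs) i = p i"
    and cneg: "cneg (list_encode zs) (list_encode (map list_encode cs)) (list_encode vs) i = q i"
    if "i < length ts" for i
    using that len by (auto simp: cpos_def cneg_def p_def q_def lnth_list_encode intro!: sum.cong)
  have pq: "int (p i) - int (q i) = lin_point zs cs (\<lambda>j. vs ! j) i" for i
    by (simp add: p_def q_def lin_point_def sum_subtractf left_diff_distrib flip: ipos_ineg)
  define W where "W n = ws ! 0 @ concat (map (\<lambda>i. npw (ts ! i) (p i) @ npw (inv_word (ts ! i)) (q i) @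
    ws ! Suc i) [0..<n])" for n
  have x: "lnth (words_code ws) i = word_code (ws ! i)" if "i \<le> length ts" for i
    using that len(1) by (simp add: words_code_def lnth_list_encode)
  have y: "lnth (words_code ts) i = word_code (ts ! i)" if "i < length ts" for i
    using that by (simp add: words_code_def lnth_list_encode)
  have start: "cpush_word 0 (lnth (words_code ws) 0) = word_code (foldl push [] (ws ! 0))"
    using x[of 0] cpush_word[of "[]" "ws ! 0"] by (simp add: word_code_def)
  have "n \<le> length ts \<Longrightarrow> rec_nat (cpush_word 0 (lnth (words_code ws) 0))
    (\<lambda>i r. cpush_word
      (cpush_inv_power
        (cpush_power r (lnth (words_code ts) i)
          (cpos (list_encode zs) (list_encode (map list_encode cs)) (list_encode vs) i))
        (lnth (words_code ts) i)
        (cneg (list_encode zs) (list_encode (map list_encode cs)) (list_encode vs) i))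
      (lnth (words_code ws) (Suc i))) n = word_code (foldl push [] (W n))" for n
  proof (induction n)
    case 0
    show ?case by (simp add: start W_def)
  next
    case (Suc n)
    then show ?case
      by (simp add: x y cpos cneg cpush_word cpush_power cpush_inv_power W_def)
  qed
  from this[of "length ts"]
  have "creduce (words_code ws) (words_code ts) (list_encode zs) (list_encode (map list_encode cs))
      (list_encode vs) = word_code (foldl push [] (W (length ts)))"
    by (simp add: creduce_def words_code_def)
  then have "creduce (words_code ws) (words_code ts) (list_encode zs) (list_encode (map list_encode cs))
      (list_encode vs) = 0 \<longleftrightarrow> W (length ts) \<approx> []"
    by (simp add: word_code_def fequiv_Nil_iff red_def)
  moreover have "W (length ts) \<approx> exp_word ws ts (lin_point zs cs (\<lambda>j. vs ! j))"
  proof -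
    have "npw (ts ! i) (p i) @ npw (inv_word (ts ! i)) (q i) @ ws ! Suc i \<approx>
        pw (ts ! i) (lin_point zs cs (\<lambda>j. vs ! j) i) @ ws ! Suc i" for i
      using fequiv_append[OF fequiv_pw_diff[of "ts ! i" "p i" "q i"] fequiv_refl[of "ws ! Suc i"]]
      by (simp add: pq)
    then show ?thesis
      unfolding W_def exp_word_def by (intro fequiv_append[OF fequiv_refl fequiv_concat])
  qed
  ultimately show ?thesis by (blast intro: free_cong.trans free_cong.sym)
qed

lemma ctest_sound:
  assumes len: "length ws = Suc (length ts)" "length zs = length ts"
    "\<forall>c\<in>set cs. length c = length ts"
    and cs: "length cs \<le> search_bound (words_code ws + words_code ts)"
    and test: "ctest (words_code ws) (words_code ts) (list_encode zs) r (list_encode (map list_encode cs))"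
  shows "exp_word ws ts (lin_point zs cs v) \<approx> []"
proof -
  define K where "K = search_bound (words_code ws + words_code ts)"
  define d where "d = length cs"
  have "length ts \<le> words_code ts"
    using length_le_list_encode[of "map word_code ts"] by (simp add: words_code_def)
  then have "(2::nat) ^ length ts \<le> 2 ^ (words_code ws + words_code ts)" by (intro power_increasing) auto
  also have "\<dots> \<le> size_bound (words_code ws + words_code ts)" by (simp add: size_bound_def)
  also have "\<dots> \<le> K"
    unfolding K_def search_bound_def Let_def
    by (meson le_code_bound le_prod_encode_1 le_trans)
  finally have K: "2 ^ length ts \<le> K" .
  have "exp_word ws ts (\<lambda>i. int_decode (zs ! i) + (\<Sum>j<d. int_decode (cs ! j ! i) * int (v j))) \<approx> []"
  proof (rule exp_word_linear)
    fix v :: "nat \<Rightarrow> nat" assume v: "\<And>j. j < d \<Longrightarrow> v j \<le> 2 ^ length ts"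
    have "v j \<le> K" if "j < d" for j using v[OF that] K by (rule le_trans)
    \<comment> \<open>The entries and the length \<open>d\<close> are at most \<open>K\<close>, so
      this list is among those tested.\<close>
    then have "list_encode (map v [0..<d]) \<le> code_bound K"
      using cs by (intro list_encode_le_code_bound) (auto simp: d_def K_def[symmetric])
    then have "creduce (words_code ws) (words_code ts) (list_encode zs) (list_encode (map list_encode cs))
        (list_encode (map v [0..<d])) = 0"
      using test unfolding ctest_def K_def[symmetric] by (simp add: d_def)
    then have "exp_word ws ts (lin_point zs cs (\<lambda>j. map v [0..<d] ! j)) \<approx> []"
      using len by (subst (asm) creduce_eq_0_iff) (auto simp: d_def)
    moreover have "lin_point zs cs (\<lambda>j. map v [0..<d] ! j) =
        (\<lambda>i. int_decode (zs ! i) + (\<Sum>j<d. int_decode (cs ! j ! i) * int (v j)))"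
      by (auto simp: lin_point_def d_def)
    ultimately show "exp_word ws ts (\<lambda>i. int_decode (zs ! i) + (\<Sum>j<d. int_decode (cs ! j ! i) * int (v j))) \<approx> []"
      by simp
  qed
  then show ?thesis by (simp add: lin_point_def[abs_def] d_def)
qed

lemma int_encode_le: "int_encode i \<le> 2 * nat \<bar>i\<bar> + 1"
  by (simp add: int_encode_def sum_encode_def nat_diff_distrib)

lemma search_complete:
  assumes len: "length ws = Suc (length ts)" and triv: "exp_word ws ts k \<approx> []"
  obtains zs cs v where "length zs = length ts" "\<forall>c\<in>set cs. length c = length ts"
    "prod_encode (list_encode zs, prod_encode (length ts, list_encode (map list_encode cs)))
      \<le> search_bound (words_code ws + words_code ts)"
    "ctest (words_code ws) (words_code ts) (list_encode zs) (length ts) (list_encode (map list_encode cs))"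
    "\<And>i. i < length ts \<Longrightarrow> k i = lin_point zs cs v i"
proof -
  define N where "N = words_code ws + words_code ts"
  define l where "l = length ts"
  define P :: nat where "P = fact (3 * N + 1)"
  define B where "B = size_bound N"
  define d where "d = 5 * l + 3"
  have elem: "x \<le> list_encode xs" if "x \<in> set xs" for x xs
    using that
  proof (induction xs)
    case (Cons a xs)
    then show ?case
      using le_prod_encode_1[of a "list_encode xs"] le_prod_encode_2[of "list_encode xs" a] by auto
  qed simp
  have wlen: "length w \<le> N" if "w \<in> set ws \<union> set ts" for w
  proof -
    have "length w \<le> word_code w"
      using length_le_list_encode[of "map (\<lambda>(i, b). prod_encode (i, of_bool b)) w"] by (simp add: word_code_def)
    also have "word_code w \<le> N"
      using that elem[of "word_code w" "map word_code ws"] elem[of "word_code w" "map word_code ts"]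
      by (auto simp: N_def words_code_def)
    finally show ?thesis .
  qed
  have lN: "l \<le> N"
    using length_le_list_encode[of "map word_code ts"] by (simp add: words_code_def N_def l_def)
  obtain z M where zM: "\<And>i. i < l \<Longrightarrow> \<bar>z i\<bar> \<le> int (4 * P * (4 * l + 3))"
    "\<And>i j. i < l \<Longrightarrow> j < d \<Longrightarrow> \<bar>M i j\<bar> \<le> int (2 * P)"
    "\<exists>v. \<forall>i<l. k i = z i + (\<Sum>j<d. M i j * int (v j))"
    "\<And>v. exp_word ws ts (\<lambda>i. z i + (\<Sum>j<d. M i j * int (v j))) \<approx> []"
    using exp_word_small_linear[OF len wlen triv] unfolding P_def l_def d_def by blast
  define zs where "zs = map (\<lambda>i. int_encode (z i)) [0..<l]"
  define cs where "cs = map (\<lambda>j. map (\<lambda>i. int_encode (M i j)) [0..<l]) [0..<d]"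
  have point: "lin_point zs cs v i = z i + (\<Sum>j<d. M i j * int (v j))" if "i < l" for v i
    using that by (simp add: lin_point_def zs_def cs_def)
  have "4 * P * (4 * l + 3) \<le> 4 * P * (4 * N + 3)" using lN by (intro mult_le_mono2) auto
  then have "2 * (4 * P * (4 * l + 3)) + 1 \<le> 2 * (4 * P * (4 * N + 3)) + 1" by linarith
  also have "\<dots> \<le> B"
    unfolding B_def size_bound_def P_def[symmetric] by (simp add: algebra_simps)
  finally have "2 * (4 * P * (4 * l + 3)) + 1 \<le> B" .
  moreover have "2 * P \<le> 4 * P * (4 * l + 3)" by simp
  moreover have "int_encode a \<le> 2 * m + 1" if "\<bar>a\<bar> \<le> int m" for a m
    using int_encode_le[of a] that by linarith
  ultimately have encB: "int_encode a \<le> B" if "\<bar>a\<bar> \<le> int (4 * P * (4 * l + 3)) \<or> \<bar>a\<bar> \<le> int (2 * P)" for a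
    using that by (meson le_trans add_le_mono1 mult_le_mono2)
  have lB: "l \<le> B" and dB: "d \<le> B" using lN by (simp_all add: B_def size_bound_def d_def)
  have zs: "list_encode zs \<le> code_bound B"
    using lB encB zM(1) by (intro list_encode_le_code_bound) (auto simp: zs_def)
  have col: "list_encode c \<le> code_bound B" if "c \<in> set cs" for c
    using that lB encB zM(2) by (intro list_encode_le_code_bound) (auto simp: cs_def)
  have "list_encode (map list_encode cs) \<le> code_bound (code_bound B)"
    using col dB le_code_bound[of B] by (intro list_encode_le_code_bound) (auto simp: cs_def)
  moreover have "list_encode zs \<le> code_bound (code_bound B)" "l \<le> code_bound (code_bound B)"
    using zs lB le_code_bound[of B] le_code_bound[of "code_bound B"] by auto
  ultimately have bound: "prod_encode (list_encode zs, prod_encode (l, list_encode (map list_encode cs)))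
      \<le> search_bound N"
    unfolding search_bound_def Let_def B_def[symmetric] by (intro prod_encode_mono)
  have lens: "length zs = l" "\<forall>c\<in>set cs. length c = l" by (auto simp: zs_def cs_def)
  have "ctest (words_code ws) (words_code ts) (list_encode zs) l (list_encode (map list_encode cs))"
    unfolding ctest_def
  proof (intro conjI allI impI)
    show "llen (list_encode zs) = llen (words_code ts)" "l = llen (words_code ts)"
      by (simp_all add: words_code_def lens l_def)
    fix j assume "j < llen (list_encode (map list_encode cs))"
    then show "llen (lnth (list_encode (map list_encode cs)) j) = llen (words_code ts)"
      using lens(2) by (simp add: words_code_def lnth_list_encode l_def)
  next
    \<comment> \<open>Every candidate \<open>c\<close> decodes to some parameter list, and by
      \<open>zM(4)\<close> all points of the linear set are solutions. A range of the test far
      beyond the box therefore rejects nothing that completeness needs.\<close>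
    fix c assume c: "llen c = llen (list_encode (map list_encode cs))"
    define vs where "vs = list_decode c"
    have "exp_word ws ts (lin_point zs cs (\<lambda>j. vs ! j)) =
        exp_word ws ts (\<lambda>i. z i + (\<Sum>j<d. M i j * int (vs ! j)))"
      by (rule exp_word_cong) (simp add: point l_def)
    then have "exp_word ws ts (lin_point zs cs (\<lambda>j. vs ! j)) \<approx> []" using zM(4) by simp
    moreover have "length vs = length cs" using c llen_list_encode[of vs] by (simp add: vs_def)
    ultimately have "creduce (words_code ws) (words_code ts) (list_encode zs)
        (list_encode (map list_encode cs)) (list_encode vs) = 0"
      using len lens by (subst creduce_eq_0_iff) (auto simp: l_def)
    then show "creduce (words_code ws) (words_code ts) (list_encode zs)
        (list_encode (map list_encode cs)) c = 0"
      by (simp add: vs_def)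
  qed
  moreover obtain v where "\<And>i. i < l \<Longrightarrow> k i = lin_point zs cs v i"
    using zM(3) point by auto
  ultimately show ?thesis using that[of zs cs v] bound lens unfolding l_def N_def by blast
qed

section \<open>Codes as vectors and matrices\<close>

definition vec_of_code :: "nat \<Rightarrow> int vec" where
  "vec_of_code c = vec_of_list (map int_decode (list_decode c))"

definition pair_of_code :: "nat \<Rightarrow> int vec \<times> int mat" where
  "pair_of_code c = (vec_of_code (pfst c),
     mat_of_cols (pfst (psnd c)) (map vec_of_code (list_decode (psnd (psnd c)))))"

lemma vec_code_vec_of_code [simp]: "vec_code (vec_of_code c) = c"
  unfolding vec_code_def vec_of_code_def list_vec by (simp add: comp_def)

lemma dim_vec_of_code [simp]: "dim_vec (vec_of_code (list_encode xs)) = length xs"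
  by (simp add: vec_of_code_def)

lemma vec_of_code_nth: "i < length xs \<Longrightarrow> vec_of_code (list_encode xs) $ i = int_decode (xs ! i)"
  by (simp add: vec_of_code_def vec_of_list_index)

lemma mem_linear_set_pair_of_code:
  assumes "length zs = l" "\<forall>c\<in>set cs. length c = l"
    and c: "c = prod_encode (list_encode zs, prod_encode (l, list_encode (map list_encode cs)))"
  shows "k \<in> (case pair_of_code c of (z, M) \<Rightarrow> linear_set z M) \<longleftrightarrow>
    k \<in> carrier_vec l \<and> (\<exists>v. \<forall>i<l. k $ i = lin_point zs cs v i)"
proof -
  define z where "z = vec_of_code (list_encode zs)"
  define M where "M = mat_of_cols l (map vec_of_code (map list_encode cs))"
  have pair: "pair_of_code c = (z, M)" by (simp add: pair_of_code_def c z_def M_def)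
  have dims: "dim_vec z = l" "dim_row M = l" "dim_col M = length cs"
    using assms(1) by (simp_all add: z_def M_def)
  have z: "z $ i = int_decode (zs ! i)" if "i < l" for i
    using that assms(1) by (simp add: z_def vec_of_code_nth)
  have M: "M $$ (i, j) = int_decode (cs ! j ! i)" if "i < l" "j < length cs" for i j
    using that assms(2) by (simp add: M_def mat_of_cols_index vec_of_code_nth)
  have point: "(z + M *\<^sub>v u) $ i = lin_point zs cs (\<lambda>j. nat (u $ j)) i"
    if "u \<in> carrier_vec (length cs)" "\<forall>j<length cs. 0 \<le> u $ j" "i < l" for u i
    using that dims
    by (auto simp: z M lin_point_def scalar_prod_def atLeast0LessThan intro!: sum.cong)
  show ?thesis
  proof
    assume "k \<in> (case pair_of_code c of (z, M) \<Rightarrow> linear_set z M)"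
    then obtain u where u: "u \<in> carrier_vec (length cs)" "\<forall>j<length cs. 0 \<le> u $ j"
      and k: "k = z + M *\<^sub>v u"
      unfolding pair prod.case linear_set_def dims by blast
    have "k \<in> carrier_vec l" unfolding k by (rule carrier_vecI) (simp add: dims)
    moreover have "\<forall>i<l. k $ i = lin_point zs cs (\<lambda>j. nat (u $ j)) i"
      unfolding k using point[OF u] by blast
    ultimately show "k \<in> carrier_vec l \<and> (\<exists>v. \<forall>i<l. k $ i = lin_point zs cs v i)" by blast
  next
    assume "k \<in> carrier_vec l \<and> (\<exists>v. \<forall>i<l. k $ i = lin_point zs cs v i)"
    then obtain v where k: "k \<in> carrier_vec l" "\<And>i. i < l \<Longrightarrow> k $ i = lin_point zs cs v i" by blast
    define u where "u = vec (length cs) (\<lambda>j. int (v j))"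
    have u: "u \<in> carrier_vec (length cs)" "\<forall>j<length cs. 0 \<le> u $ j" by (simp_all add: u_def)
    have "k = z + M *\<^sub>v u"
    proof (rule eq_vecI)
      fix i assume "i < dim_vec (z + M *\<^sub>v u)"
      then have i: "i < l" by (simp add: dims)
      have "lin_point zs cs (\<lambda>j. nat (u $ j)) i = lin_point zs cs v i"
        by (simp add: lin_point_def u_def)
      then show "k $ i = (z + M *\<^sub>v u) $ i" using point[OF u i] k(2)[OF i] by simp
    qed (use k dims in auto)
    then show "k \<in> (case pair_of_code c of (z, M) \<Rightarrow> linear_set z M)"
      using u unfolding pair prod.case linear_set_def dims by blast
  qed
qed

text \<open>Every number decodes to some lists; the length checks in \<open>ctest\<close> force
  these into the shape of a vector and a matrix with \<open>llen y\<close> rows.\<close>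

lemma ctest_decode:
  assumes "ctest x y (pfst c) (pfst (psnd c)) (psnd (psnd c))"
  obtains zs cs where "length zs = llen y" "\<forall>c\<in>set cs. length c = llen y"
    "c = prod_encode (list_encode zs, prod_encode (llen y, list_encode (map list_encode cs)))"
proof
  define zs where "zs = list_decode (pfst c)"
  define cs where "cs = map list_decode (list_decode (psnd (psnd c)))"
  have z: "pfst c = list_encode zs" by (simp add: zs_def)
  have q: "psnd (psnd c) = list_encode (map list_encode cs)" by (simp add: cs_def comp_def)
  have r: "pfst (psnd c) = llen y" using assms by (simp add: ctest_def)
  show "length zs = llen y" using assms by (simp add: ctest_def z)
  show "\<forall>c\<in>set cs. length c = llen y"
  proof
    fix c' assume "c' \<in> set cs"
    then obtain j where "j < length cs" "c' = cs ! j" by (metis in_set_conv_nth)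
    then show "length c' = llen y" using assms unfolding ctest_def q by (simp add: lnth_list_encode)
  qed
  show "c = prod_encode (list_encode zs, prod_encode (llen y, list_encode (map list_encode cs)))"
    unfolding z[symmetric] q[symmetric] r[symmetric] by simp
qed

text \<open>All columns have length \<open>l\<close>, so \<open>cols\<close> recovers what
  \<open>mat_of_cols\<close> was given. The candidate number is thus itself the code of its pair and
  can be output unchanged.\<close>

lemma code_pair_of_code:
  assumes "length zs = l" "\<forall>c\<in>set cs. length c = l"
    and c: "c = prod_encode (list_encode zs, prod_encode (l, list_encode (map list_encode cs)))"
  shows "(case pair_of_code c of (z, M) \<Rightarrow> prod_encode (vec_code z, mat_code M)) = c"
    "case pair_of_code c of (z, M) \<Rightarrow> z \<in> carrier_vec l \<and> (\<exists>d. M \<in> carrier_mat l d)"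
proof -
  have "cols (mat_of_cols l (map vec_of_code (map list_encode cs))) = map vec_of_code (map list_encode cs)"
    using assms(2) by (intro cols_mat_of_cols) (auto intro!: carrier_vecI)
  then show "(case pair_of_code c of (z, M) \<Rightarrow> prod_encode (vec_code z, mat_code M)) = c"
    by (simp add: c pair_of_code_def mat_code_def comp_def)
  show "case pair_of_code c of (z, M) \<Rightarrow> z \<in> carrier_vec l \<and> (\<exists>d. M \<in> carrier_mat l d)"
    using assms(1) by (auto simp: c pair_of_code_def intro!: carrier_vecI exI mat_of_cols_carrier(1))
qed

theorem theorem3p4:
  shows "\<exists>alg :: recf. \<forall>g \<ge> (1 :: nat). \<forall>l :: nat. \<forall>ws ts :: nat word list.
    set ws \<subseteq> words {1..g} \<longrightarrow> set ts \<subseteq> words {1..g} \<longrightarrow>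
    length ws = Suc l \<longrightarrow> length ts = l \<longrightarrow>
    (\<exists>As :: (int vec \<times> int mat) list.
       rec_eval alg [words_code ws, words_code ts] (output_code As) \<and>
       (\<forall>(z, M) \<in> set As. z \<in> carrier_vec l \<and> (\<exists>d. M \<in> carrier_mat l d)) \<and>
       exp_solutions (free_group {1..g})
         (map (word_class {1..g}) ws) (map (word_class {1..g}) ts)
       = (\<Union>(z, M) \<in> set As. linear_set z M))"
proof -
  \<comment> \<open>The function is chosen before \<open>g\<close>, \<open>l\<close> and the words:
    reduction does not refer to the generating set.\<close>
  obtain alg where alg: "\<And>e. length e = 2 \<Longrightarrow> rec_eval alg e (calg (e ! 0) (e ! 1))"
    using computable_calg by (auto simp: computable_def)
  show ?thesis
  proof (intro exI[of _ alg] allI impI)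
    fix g l :: nat and ws ts :: "nat word list"
    assume X: "set ws \<subseteq> words {1..g}" "set ts \<subseteq> words {1..g}"
      and len: "length ws = Suc l" "length ts = l"
    define x where "x = words_code ws"
    define y where "y = words_code ts"
    define test where "test c \<longleftrightarrow> ctest x y (pfst c) (pfst (psnd c)) (psnd (psnd c))" for c
    define C where "C = rev (filter test [0..<Suc (search_bound (x + y))])"
    define As where "As = map pair_of_code C"
    have y: "llen y = l" by (simp add: y_def words_code_def len)
    have setC: "c \<in> set C \<longleftrightarrow> test c \<and> c \<le> search_bound (x + y)" for c
      by (auto simp: C_def less_Suc_eq_le simp del: upt_Suc)
    have dec: "\<exists>zs cs. length zs = l \<and> (\<forall>c\<in>set cs. length c = l) \<and>
        c = prod_encode (list_encode zs, prod_encode (l, list_encode (map list_encode cs)))"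
      if "test c" for c
      using that unfolding test_def by (elim ctest_decode) (unfold y, blast)
    have code: "(case pair_of_code c of (z, M) \<Rightarrow> prod_encode (vec_code z, mat_code M)) = c"
      "case pair_of_code c of (z, M) \<Rightarrow> z \<in> carrier_vec l \<and> (\<exists>d. M \<in> carrier_mat l d)"
      if "c \<in> set C" for c
    proof -
      have "test c" using that by (simp add: setC)
      from dec[OF this] obtain zs cs where zs: "length zs = l" "\<forall>c\<in>set cs. length c = l"
        "c = prod_encode (list_encode zs, prod_encode (l, list_encode (map list_encode cs)))"
        by blast
      show "(case pair_of_code c of (z, M) \<Rightarrow> prod_encode (vec_code z, mat_code M)) = c"
        "case pair_of_code c of (z, M) \<Rightarrow> z \<in> carrier_vec l \<and> (\<exists>d. M \<in> carrier_mat l d)"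
        by (rule code_pair_of_code[OF zs])+
    qed
    have "output_code As = list_encode C"
      unfolding output_code_def As_def map_map comp_def using code(1) by (simp add: map_idI)
    then have "rec_eval alg [words_code ws, words_code ts] (output_code As)"
      using alg[of "[x, y]"] by (simp add: calg_eq C_def test_def[abs_def] x_def y_def)
    moreover have "\<forall>(z, M) \<in> set As. z \<in> carrier_vec l \<and> (\<exists>d. M \<in> carrier_mat l d)"
      using code(2) by (auto simp: As_def)
    moreover have "exp_solutions (free_group {1..g})
        (map (word_class {1..g}) ws) (map (word_class {1..g}) ts) =
      (\<Union>(z, M) \<in> set As. linear_set z M)"
    proof -
      have lt: "length ws = Suc (length ts)" by (simp add: len)
      have "exp_solutions (free_group {1..g}) (map (word_class {1..g}) ws) (map (word_class {1..g}) ts)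
          = {k \<in> carrier_vec l. exp_word ws ts (\<lambda>i. k $ i) \<approx> []}"
        using exp_solutions_free_group[OF X lt] by (simp add: len)
      also have "\<dots> = (\<Union>c\<in>set C. case pair_of_code c of (z, M) \<Rightarrow> linear_set z M)"
      proof (intro equalityI subsetI)
        fix k assume "k \<in> {k \<in> carrier_vec l. exp_word ws ts (\<lambda>i. k $ i) \<approx> []}"
        then have k: "k \<in> carrier_vec l" "exp_word ws ts (\<lambda>i. k $ i) \<approx> []" by auto
        obtain zs cs v where zs: "length zs = l" "\<forall>c\<in>set cs. length c = l"
          "prod_encode (list_encode zs, prod_encode (l, list_encode (map list_encode cs)))
            \<le> search_bound (x + y)"
          "ctest x y (list_encode zs) l (list_encode (map list_encode cs))"
          "\<And>i. i < l \<Longrightarrow> k $ i = lin_point zs cs v i"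
          using search_complete[OF lt k(2)] unfolding len x_def y_def by metis
        define c where "c = prod_encode (list_encode zs, prod_encode (l, list_encode (map list_encode cs)))"
        have "c \<in> set C" using zs(3,4) unfolding setC test_def by (simp add: c_def)
        moreover have "k \<in> (case pair_of_code c of (z, M) \<Rightarrow> linear_set z M)"
          unfolding mem_linear_set_pair_of_code[OF zs(1,2) c_def] using k(1) zs(5) by blast
        ultimately show "k \<in> (\<Union>c\<in>set C. case pair_of_code c of (z, M) \<Rightarrow> linear_set z M)"
          by (rule UN_I)
      next
        fix k assume "k \<in> (\<Union>c\<in>set C. case pair_of_code c of (z, M) \<Rightarrow> linear_set z M)"
        then obtain c where "c \<in> set C"
          and k: "k \<in> (case pair_of_code c of (z, M) \<Rightarrow> linear_set z M)"
          by (rule UN_E)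
        then have c: "test c" "c \<le> search_bound (x + y)" by (simp_all add: setC)
        obtain zs cs where zs: "length zs = l" "\<forall>c\<in>set cs. length c = l"
          and c_eq: "c = prod_encode (list_encode zs, prod_encode (l, list_encode (map list_encode cs)))"
          using dec[OF c(1)] by blast
        obtain v where v: "k \<in> carrier_vec l" "\<And>i. i < l \<Longrightarrow> k $ i = lin_point zs cs v i"
          using k unfolding mem_linear_set_pair_of_code[OF zs c_eq] by blast
        \<comment> \<open>The number of columns must be bounded for \<open>ctest_sound\<close>,
          whose test points would otherwise not be known to have codes in the tested range.\<close>
        have "length cs \<le> list_encode (map list_encode cs)"
          using length_le_list_encode[of "map list_encode cs"] by simp
        also have "\<dots> \<le> c" unfolding c_eq by (meson le_prod_encode_2 le_trans)
        finally have "length cs \<le> search_bound (words_code ws + words_code ts)"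
          using c(2) by (simp add: x_def y_def)
        then have "exp_word ws ts (lin_point zs cs v) \<approx> []"
          using ctest_sound[of ws ts zs cs l v] c(1) zs len unfolding test_def c_eq x_def y_def
          by simp
        moreover have "exp_word ws ts (\<lambda>i. k $ i) = exp_word ws ts (lin_point zs cs v)"
          by (rule exp_word_cong) (simp add: v len)
        ultimately show "k \<in> {k \<in> carrier_vec l. exp_word ws ts (\<lambda>i. k $ i) \<approx> []}"
          using v(1) by simp
      qed
      also have "\<dots> = (\<Union>(z, M) \<in> set As. linear_set z M)" by (simp add: As_def)
      finally show ?thesis .
    qed
    ultimately show "\<exists>As. rec_eval alg [words_code ws, words_code ts] (output_code As) \<and>
        (\<forall>(z, M) \<in> set As. z \<in> carrier_vec l \<and> (\<exists>d. M \<in> carrier_mat l d)) \<and>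
        exp_solutions (free_group {1..g}) (map (word_class {1..g}) ws) (map (word_class {1..g}) ts) =
        (\<Union>(z, M) \<in> set As. linear_set z M)"
      by blast
  qed
qed

end
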